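(* Assume A1–A5 (stated in the context). Let $f_n=\sum_{j=1}^\infty\theta_{nj}\phi_j$ be a sequence of alternatives with $cn^{-r}\le\|f_n\|\le Cn^{-r}$ for all $n$, where $0<c<C<\infty$. Then the sequence $f_n$ is inconsistent (for the test statistics $T_n$) if and only if for any $c_2>0$ $$\sum_{j<c_2k_n}\theta_{nj}^2=o(n^{-2r})\qquad\text{as } n\to\infty .$$
   Context: Setting. Fix $0<r<1/2$ and $\sigma>0$. One observes $dY_n(t)=f(t)\,dt+\frac{\sigma}{\sqrt n}\,dw(t)$, $t\in[0,1]$, with unknown signal $f\in L_2(0,1)$ and Gaussian white noise $dw$. Let $(\phi_j)_{j\ge1}$ be an orthonormal basis of $L_2(0,1)$; then $y_j=\int_0^1\phi_j\,dY_n=\theta_j+\frac{\sigma}{\sqrt n}\xi_j$ with $\theta_j=\int_0^1f\phi_j\,dt$ and $\xi_j$ i.i.d. standard Gaussian. The hypothesis is $f=0$; alternatives are $f=f_n$. The test statistics are $$T_n=\sum_{j=1}^\infty\kappa_{nj}^2y_j^2-\sigma^2n^{-1}\rho_n,\qquad \rho_n=\sum_{j=1}^\infty\kappa_{nj}^2 .$$ Assumptions on the coefficients. $[\cdot]$ is the integer part; $a_n\asymp b_n$ means that $a_n/b_n$ is bounded between two positive constants. A1: for each $n$ the sequence $\kappa_{nj}^2$, $j\ge1$, is decreasing. A2: there are positive constants $C_1,C_2$ such that $C_1<A_n=\sigma^{-4}n^2\sum_{j=1}^\infty\kappa_{nj}^4<C_2$ for each $n$. A3: there are positive constants $c_1,c_2$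 such that $c_1n^{-2r}\le\rho_n\le c_2n^{-2r}$. Put $k_n=\sup\{k:\sum_{j<k}\kappa_{nj}^2\le\frac12\rho_n\}$ and $\kappa_n^2=\kappa_{nk_n}^2$. A4: there are $C_1$ and $\lambda>1$ such that $\kappa^2_{n,[(1+\delta)k_n]}<C_1(1+\delta)^{-\lambda}\kappa_n^2$ for any $\delta>0$ and each $n$. A5: $\kappa_{n1}^2\asymp\kappa_n^2$ as $n\to\infty$, and for any $c>1$ there is $C>0$ such that $\kappa_{n,[ck_n]}^2\ge C\kappa_n^2$ for all $n$. Tests. A test $K_n$ generated by $T_n$ rejects the hypothesis when $T_n$ exceeds a threshold; $\alpha(K_n)$ is its type I error probability and $\beta(K_n,f)$ its type II error probability at $f$. A sequence $f_n$ is inconsistent if for each sequence of tests $K_n$ generated by $T_n$ one has $\liminf_{n\to\infty}(\alpha(K_n)+\beta(K_n,f_n))\ge1$. *)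

theory Defs
  imports "HOL-Probability.Probability" "HOL-Library.Landau_Symbols"
begin

text \<open>
  All sequences are indexed by \<open>j \<ge> 1\<close>; the value at index 0 is never used, and infinite series
  are written with \<open>Suc j\<close>. Likewise only sample indices \<open>n \<ge> 1\<close> matter.
\<close>

section \<open>The space \<open>L\<^sub>2(0,1)\<close>\<close>

text \<open>Elements are represented by functions, not by classes modulo equality almost everywhere.\<close>

abbreviation leb01 :: "real measure" where
  "leb01 \<equiv> lebesgue_on {0<..<1}"

definition L2 :: "(real \<Rightarrow> real) set" where
  "L2 = {g \<in> borel_measurable leb01. integrable leb01 (\<lambda>t. (g t)\<^sup>2)}"

definition L2_inner :: "(real \<Rightarrow> real) \<Rightarrow> (real \<Rightarrow> real) \<Rightarrow> real" where
  "L2_inner g h = (LINT t|leb01. g t * h t)"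

definition L2_norm :: "(real \<Rightarrow> real) \<Rightarrow> real" where
  "L2_norm g = sqrt (LINT t|leb01. (g t)\<^sup>2)"

definition L2_orthonormal :: "(nat \<Rightarrow> real \<Rightarrow> real) \<Rightarrow> bool" where
  "L2_orthonormal e \<longleftrightarrow>
     (\<forall>j\<ge>1. e j \<in> L2) \<and>
     (\<forall>i\<ge>1. \<forall>j\<ge>1. L2_inner (e i) (e j) = (if i = j then 1 else 0))"

text \<open>An orthonormal basis: every \<open>g\<close> is the norm limit of its Fourier series.\<close>

definition L2_orthonormal_basis :: "(nat \<Rightarrow> real \<Rightarrow> real) \<Rightarrow> bool" where
  "L2_orthonormal_basis e \<longleftrightarrow>
     L2_orthonormal e \<and>
     (\<forall>g\<in>L2. (\<lambda>N. L2_norm (\<lambda>t. g t - (\<Sum>j=1..N. L2_inner g (e j) * e j t))) \<longlonglongrightarrow> 0)"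

section \<open>Observations in Gaussian white noise\<close>

text \<open>
  \<open>W g\<close> stands for the stochastic integral of \<open>g\<close> with respect to \<open>dw\<close>: \<open>W\<close> is an almost surely
  linear map on \<open>L\<^sub>2(0,1)\<close> sending every orthonormal sequence to independent standard Gaussian
  variables (so \<open>W g\<close> is centred Gaussian and \<open>W g\<close>, \<open>W h\<close> have covariance \<open>L2_inner g h\<close>).
\<close>

definition white_noise :: "'a measure \<Rightarrow> ((real \<Rightarrow> real) \<Rightarrow> 'a \<Rightarrow> real) \<Rightarrow> bool" where
  "white_noise M W \<longleftrightarrow>
     prob_space M \<and>
     (\<forall>g\<in>L2. W g \<in> borel_measurable M) \<and>
     (\<forall>g\<in>L2. \<forall>h\<in>L2. \<forall>a b.
        AE \<omega> in M. W (\<lambda>t. a * g t + b * h t) \<omega> = a * W g \<omega> + b * W h \<omega>) \<and>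
     (\<forall>e. L2_orthonormal e \<longrightarrow>
        prob_space.indep_vars M (\<lambda>_. borel) (\<lambda>j. W (e j)) {1..} \<and>
        (\<forall>j\<ge>1. distributed M lborel (W (e j)) std_normal_density))"

text \<open>\<open>dY_integral \<sigma> W n f g\<close> is the integral of \<open>g\<close> with respect to
  \<open>dY\<^sub>n(t) = f(t) dt + (\<sigma> / sqrt n) dw(t)\<close>.\<close>

definition dY_integral ::
  "real \<Rightarrow> ((real \<Rightarrow> real) \<Rightarrow> 'a \<Rightarrow> real) \<Rightarrow> nat \<Rightarrow> (real \<Rightarrow> real) \<Rightarrow> (real \<Rightarrow> real) \<Rightarrow> 'a \<Rightarrow> real" where
  "dY_integral \<sigma> W n f g \<omega> = L2_inner f g + \<sigma> / sqrt (real n) * W g \<omega>"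

definition observation ::
  "real \<Rightarrow> ((real \<Rightarrow> real) \<Rightarrow> 'a \<Rightarrow> real) \<Rightarrow> (nat \<Rightarrow> real \<Rightarrow> real) \<Rightarrow> nat \<Rightarrow> (real \<Rightarrow> real)
     \<Rightarrow> 'a \<Rightarrow> nat \<Rightarrow> real" where
  "observation \<sigma> W \<phi> n f \<omega> = (\<lambda>j. dY_integral \<sigma> W n f (\<phi> j) \<omega>)"

section \<open>Test statistics and assumptions on the coefficients\<close>

definition rho :: "(nat \<Rightarrow> nat \<Rightarrow> real) \<Rightarrow> nat \<Rightarrow> real" where
  "rho \<kappa> n = (\<Sum>j. (\<kappa> n (Suc j))\<^sup>2)"

definition T_stat :: "real \<Rightarrow> (nat \<Rightarrow> nat \<Rightarrow> real) \<Rightarrow> nat \<Rightarrow> (nat \<Rightarrow> real) \<Rightarrow> real" where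
  "T_stat \<sigma> \<kappa> n y = (\<Sum>j. (\<kappa> n (Suc j))\<^sup>2 * (y (Suc j))\<^sup>2) - \<sigma>\<^sup>2 / real n * rho \<kappa> n"

definition A_coef :: "real \<Rightarrow> (nat \<Rightarrow> nat \<Rightarrow> real) \<Rightarrow> nat \<Rightarrow> real" where
  "A_coef \<sigma> \<kappa> n = (real n)\<^sup>2 / \<sigma> ^ 4 * (\<Sum>j. (\<kappa> n (Suc j)) ^ 4)"

definition k_idx :: "(nat \<Rightarrow> nat \<Rightarrow> real) \<Rightarrow> nat \<Rightarrow> nat" where
  "k_idx \<kappa> n = Sup {k. (\<Sum>j\<in>{1..<k}. (\<kappa> n j)\<^sup>2) \<le> rho \<kappa> n / 2}"

definition kappa_sq :: "(nat \<Rightarrow> nat \<Rightarrow> real) \<Rightarrow> nat \<Rightarrow> real" where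
  "kappa_sq \<kappa> n = (\<kappa> n (k_idx \<kappa> n))\<^sup>2"

definition asymp_comparable :: "(nat \<Rightarrow> real) \<Rightarrow> (nat \<Rightarrow> real) \<Rightarrow> bool" where
  "asymp_comparable a b \<longleftrightarrow>
     (\<exists>c>0. \<exists>C>0. \<forall>\<^sub>F n in sequentially. c \<le> a n / b n \<and> a n / b n \<le> C)"

definition cond_A1 :: "(nat \<Rightarrow> nat \<Rightarrow> real) \<Rightarrow> bool" where
  "cond_A1 \<kappa> \<longleftrightarrow> (\<forall>n\<ge>1. \<forall>i j. 1 \<le> i \<longrightarrow> i \<le> j \<longrightarrow> (\<kappa> n j)\<^sup>2 \<le> (\<kappa> n i)\<^sup>2)"

definition cond_A2 :: "real \<Rightarrow> (nat \<Rightarrow> nat \<Rightarrow> real) \<Rightarrow> bool" where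
  "cond_A2 \<sigma> \<kappa> \<longleftrightarrow>
     (\<exists>C1>0. \<exists>C2>0. \<forall>n\<ge>1. summable (\<lambda>j. (\<kappa> n (Suc j)) ^ 4) \<and>
        C1 < A_coef \<sigma> \<kappa> n \<and> A_coef \<sigma> \<kappa> n < C2)"

definition cond_A3 :: "real \<Rightarrow> (nat \<Rightarrow> nat \<Rightarrow> real) \<Rightarrow> bool" where
  "cond_A3 r \<kappa> \<longleftrightarrow>
     (\<exists>c1>0. \<exists>c2>0. \<forall>n\<ge>1. summable (\<lambda>j. (\<kappa> n (Suc j))\<^sup>2) \<and>
        c1 * real n powr (- 2 * r) \<le> rho \<kappa> n \<and> rho \<kappa> n \<le> c2 * real n powr (- 2 * r))"

definition cond_A4 :: "(nat \<Rightarrow> nat \<Rightarrow> real) \<Rightarrow> bool" where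
  "cond_A4 \<kappa> \<longleftrightarrow>
     (\<exists>C1. \<exists>l>1. \<forall>n\<ge>1. \<forall>\<delta>>0.
        (\<kappa> n (nat \<lfloor>(1 + \<delta>) * real (k_idx \<kappa> n)\<rfloor>))\<^sup>2
          < C1 * (1 + \<delta>) powr (- l) * kappa_sq \<kappa> n)"

definition cond_A5 :: "(nat \<Rightarrow> nat \<Rightarrow> real) \<Rightarrow> bool" where
  "cond_A5 \<kappa> \<longleftrightarrow>
     asymp_comparable (\<lambda>n. (\<kappa> n 1)\<^sup>2) (kappa_sq \<kappa>) \<and>
     (\<forall>c>1. \<exists>C>0. \<forall>n\<ge>1.
        (\<kappa> n (nat \<lfloor>c * real (k_idx \<kappa> n)\<rfloor>))\<^sup>2 \<ge> C * kappa_sq \<kappa> n)"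

section \<open>Tests\<close>

text \<open>A test maps the observation \<open>y\<close> to \<open>True\<close> if it rejects the hypothesis.\<close>

definition generated_by :: "((nat \<Rightarrow> real) \<Rightarrow> bool) \<Rightarrow> ((nat \<Rightarrow> real) \<Rightarrow> real) \<Rightarrow> bool" where
  "generated_by K T \<longleftrightarrow> (\<exists>x::real. K = (\<lambda>y. T y > x))"

definition type1_error ::
  "'a measure \<Rightarrow> ((real \<Rightarrow> real) \<Rightarrow> 'a \<Rightarrow> real) \<Rightarrow> real \<Rightarrow> (nat \<Rightarrow> real \<Rightarrow> real) \<Rightarrow> nat
     \<Rightarrow> ((nat \<Rightarrow> real) \<Rightarrow> bool) \<Rightarrow> real" where
  "type1_error M W \<sigma> \<phi> n K =
     measure M {\<omega> \<in> space M. K (observation \<sigma> W \<phi> n (\<lambda>_. 0) \<omega>)}"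

definition type2_error ::
  "'a measure \<Rightarrow> ((real \<Rightarrow> real) \<Rightarrow> 'a \<Rightarrow> real) \<Rightarrow> real \<Rightarrow> (nat \<Rightarrow> real \<Rightarrow> real) \<Rightarrow> nat
     \<Rightarrow> ((nat \<Rightarrow> real) \<Rightarrow> bool) \<Rightarrow> (real \<Rightarrow> real) \<Rightarrow> real" where
  "type2_error M W \<sigma> \<phi> n K f =
     measure M {\<omega> \<in> space M. \<not> K (observation \<sigma> W \<phi> n f \<omega>)}"

definition inconsistent ::
  "'a measure \<Rightarrow> ((real \<Rightarrow> real) \<Rightarrow> 'a \<Rightarrow> real) \<Rightarrow> real \<Rightarrow> (nat \<Rightarrow> real \<Rightarrow> real)
     \<Rightarrow> (nat \<Rightarrow> nat \<Rightarrow> real) \<Rightarrow> (nat \<Rightarrow> real \<Rightarrow> real) \<Rightarrow> bool" where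
  "inconsistent M W \<sigma> \<phi> \<kappa> f \<longleftrightarrow>
     (\<forall>K. (\<forall>n\<ge>1. generated_by (K n) (T_stat \<sigma> \<kappa> n)) \<longrightarrow>
        liminf (\<lambda>n. ereal (type1_error M W \<sigma> \<phi> n (K n) + type2_error M W \<sigma> \<phi> n (K n) (f n))) \<ge> 1)"

end

theory Submission imports Defs begin

text \<open>
  Put \<open>a\<^sub>j = n \<kappa>\<^sub>n\<^sub>j\<^sup>2 / \<sigma>\<^sup>2\<close> and \<open>b\<^sub>j = sqrt n \<theta>\<^sub>n\<^sub>j / \<sigma>\<close>. Up to the factor \<open>\<sigma>\<^sup>4 / n\<^sup>2\<close>,
  the test statistic is \<open>U\<^sub>0 = \<Sum> a\<^sub>j (\<xi>\<^sub>j\<^sup>2 - 1)\<close> under the hypothesis and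
  \<open>U\<^sub>b = \<Sum> a\<^sub>j ((\<xi>\<^sub>j + b\<^sub>j)\<^sup>2 - 1) = U\<^sub>0 + D + L\<close> under the alternative, where
  \<open>D = \<Sum> a\<^sub>j b\<^sub>j\<^sup>2\<close> is a deterministic shift and \<open>L = 2 \<Sum> a\<^sub>j b\<^sub>j \<xi>\<^sub>j\<close>. In this scale
  \<open>\<Sum> a\<^sub>j\<^sup>2 = A\<^sub>n\<close> stays between two positive constants, while \<open>max a\<^sub>j = a\<^sub>1 \<longlonglongrightarrow> 0\<close>; since
  \<open>Var L \<le> 4 a\<^sub>1 D\<close>, the linear term \<open>L\<close> is negligible against the larger of \<open>D\<close> and any fixed
  constant. So everything is decided by the shift: the alternatives are inconsistent if and only
  if \<open>D \<longlonglongrightarrow> 0\<close> (\<open>no_power_iff_shift_vanishes\<close>).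

  If \<open>D \<longlonglongrightarrow> 0\<close>, then, outside an event of vanishing probability, \<open>U\<^sub>0\<close> and \<open>U\<^sub>b\<close> can lie on different
  sides of a threshold \<open>x\<close> only when \<open>U\<^sub>0\<close> lies in a short interval around \<open>x\<close>. This is unlikely
  uniformly in \<open>x\<close>: \<open>U\<^sub>0\<close> is a sum of many small independent terms, its characteristic function
  decays like that of a Gaussian with variance \<open>\<Sum> a\<^sub>j\<^sup>2\<close> on a range of frequencies of order
  \<open>1 / a\<^sub>1\<close>, and averaging against a Gaussian kernel turns the decay into a bound on the probability
  of short intervals (\<open>centred_quad_concentration\<close>).

  If \<open>D\<close> exceeds \<open>2 \<delta>\<close> infinitely often, Chebyshev keeps \<open>U\<^sub>0\<close> in a fixed bounded interval with
  probability at least \<open>1/2\<close>, so some interval \<open>(x - \<delta>, x]\<close> carries a fixed amount of mass; the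
  shift pushes this mass over the threshold \<open>x\<close>, which gives a test with some power.

  It remains to read \<open>D = n\<^sup>2 / \<sigma>\<^sup>4 \<Sum> \<kappa>\<^sub>n\<^sub>j\<^sup>2 \<theta>\<^sub>n\<^sub>j\<^sup>2\<close> in terms of the low coefficients. The assumptions
  force \<open>\<kappa>\<^sub>n\<^sup>2\<close> to have the order of \<open>n powr (2 * r - 2)\<close>, so that \<open>n\<^sup>2 \<kappa>\<^sub>n\<^sup>2\<close> times a signal energy of
  order \<open>n powr (- 2 * r)\<close> is of constant order. By A5 the weights \<open>\<kappa>\<^sub>n\<^sub>j\<^sup>2\<close> with \<open>j < c\<^sub>2 k\<^sub>n\<close> are
  comparable to \<open>\<kappa>\<^sub>n\<^sup>2\<close>, and by A4 those with \<open>j \<ge> c\<^sub>2 k\<^sub>n\<close> are at most \<open>\<epsilon> \<kappa>\<^sub>n\<^sup>2\<close> once \<open>c\<^sub>2\<close> is large;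
  together with Bessel's inequality this gives the criterion (\<open>weighted_energy_vanishes_iff\<close>).
\<close>

section \<open>Series of independent centred variables\<close>

lemma (in prob_space) second_moment_indep_sum:
  fixes Y :: "'i \<Rightarrow> 'a \<Rightarrow> real"
  assumes "finite I" "indep_vars (\<lambda>_. borel) Y I"
    and "\<And>i. i \<in> I \<Longrightarrow> integrable M (Y i)"
    and "\<And>i. i \<in> I \<Longrightarrow> integrable M (\<lambda>\<omega>. (Y i \<omega>)\<^sup>2)"
    and "\<And>i. i \<in> I \<Longrightarrow> expectation (Y i) = 0"
  shows "integrable M (\<lambda>\<omega>. (\<Sum>i\<in>I. Y i \<omega>)\<^sup>2) \<and>
    expectation (\<lambda>\<omega>. (\<Sum>i\<in>I. Y i \<omega>)\<^sup>2) = (\<Sum>i\<in>I. expectation (\<lambda>\<omega>. (Y i \<omega>)\<^sup>2))"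
  using assms
proof (induction I)
  case (insert i I)
  have IH: "integrable M (\<lambda>\<omega>. (\<Sum>i\<in>I. Y i \<omega>)\<^sup>2)"
    "expectation (\<lambda>\<omega>. (\<Sum>i\<in>I. Y i \<omega>)\<^sup>2) = (\<Sum>i\<in>I. expectation (\<lambda>\<omega>. (Y i \<omega>)\<^sup>2))"
    using insert.IH indep_vars_subset[OF insert.prems(1)] insert.prems by blast+
  have ind: "indep_var borel (Y i) borel (\<lambda>\<omega>. \<Sum>i\<in>I. Y i \<omega>)"
    using insert.hyps insert.prems(1) by (rule indep_vars_sum)
  have S: "integrable M (\<lambda>\<omega>. \<Sum>i\<in>I. Y i \<omega>)"
    using insert.prems by auto
  have cross: "integrable M (\<lambda>\<omega>. Y i \<omega> * (\<Sum>i\<in>I. Y i \<omega>))"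
    "expectation (\<lambda>\<omega>. Y i \<omega> * (\<Sum>i\<in>I. Y i \<omega>)) = 0"
    using indep_var_integrable[OF ind _ S] indep_var_lebesgue_integral[OF ind _ S] insert.prems by auto
  have sq: "(\<lambda>\<omega>. (\<Sum>i\<in>insert i I. Y i \<omega>)\<^sup>2) =
      (\<lambda>\<omega>. (Y i \<omega>)\<^sup>2 + 2 * (Y i \<omega> * (\<Sum>i\<in>I. Y i \<omega>)) + (\<Sum>i\<in>I. Y i \<omega>)\<^sup>2)"
    using insert.hyps by (simp add: power2_sum algebra_simps)
  show ?case
    unfolding sq using IH cross insert.prems insert.hyps by simp
qed simp

text \<open>
  Chebyshev's inequality for an infinite sum: Fatou's lemma carries the second moment bound from
  the partial sums to the almost sure limit.
\<close>

lemma (in prob_space) indep_series_tail: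
  fixes Y :: "nat \<Rightarrow> 'a \<Rightarrow> real"
  assumes ind: "indep_vars (\<lambda>_. borel) Y UNIV"
    and int: "\<And>i. integrable M (Y i)" "\<And>i. integrable M (\<lambda>\<omega>. (Y i \<omega>)\<^sup>2)"
    and zero: "\<And>i. expectation (Y i) = 0"
    and var: "\<And>i. expectation (\<lambda>\<omega>. (Y i \<omega>)\<^sup>2) \<le> v i" "summable v"
    and conv: "AE \<omega> in M. summable (\<lambda>i. Y i \<omega>)"
    and "0 < \<epsilon>"
  shows "prob {\<omega> \<in> space M. \<epsilon> \<le> \<bar>\<Sum>i. Y i \<omega>\<bar>} \<le> (\<Sum>i. v i) / \<epsilon>\<^sup>2"
proof -
  have [measurable]: "Y i \<in> borel_measurable M" for i using int(1) by auto
  have v0: "0 \<le> v i" for i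
    by (rule order_trans[OF _ var(1)]) (rule Bochner_Integration.integral_nonneg, simp)
  have "(\<integral>\<^sup>+\<omega>. ennreal ((\<Sum>i. Y i \<omega>)\<^sup>2) \<partial>M)
      \<le> (\<integral>\<^sup>+\<omega>. liminf (\<lambda>N. ennreal ((\<Sum>i<N. Y i \<omega>)\<^sup>2)) \<partial>M)"
  proof (rule nn_integral_mono_AE)
    show "AE \<omega> in M. ennreal ((\<Sum>i. Y i \<omega>)\<^sup>2) \<le> liminf (\<lambda>N. ennreal ((\<Sum>i<N. Y i \<omega>)\<^sup>2))"
      using conv
    proof eventually_elim
      case (elim \<omega>)
      have "(\<lambda>N. ennreal ((\<Sum>i<N. Y i \<omega>)\<^sup>2)) \<longlonglongrightarrow> ennreal ((\<Sum>i. Y i \<omega>)\<^sup>2)"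
        by (intro tendsto_ennrealI tendsto_power summable_LIMSEQ elim)
      from lim_imp_Liminf[OF sequentially_bot this] show ?case by simp
    qed
  qed
  also have "\<dots> \<le> liminf (\<lambda>N. \<integral>\<^sup>+\<omega>. ennreal ((\<Sum>i<N. Y i \<omega>)\<^sup>2) \<partial>M)"
    by (rule nn_integral_liminf) measurable
  also have "\<dots> \<le> liminf (\<lambda>N::nat. ennreal (\<Sum>i. v i))"
  proof (rule Liminf_mono, rule always_eventually, rule allI)
    fix N :: nat
    have *: "integrable M (\<lambda>\<omega>. (\<Sum>i<N. Y i \<omega>)\<^sup>2)"
      "expectation (\<lambda>\<omega>. (\<Sum>i<N. Y i \<omega>)\<^sup>2) = (\<Sum>i<N. expectation (\<lambda>\<omega>. (Y i \<omega>)\<^sup>2))"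
      using second_moment_indep_sum[of "{..<N}" Y] indep_vars_subset[OF ind] int zero by auto
    have "(\<integral>\<^sup>+\<omega>. ennreal ((\<Sum>i<N. Y i \<omega>)\<^sup>2) \<partial>M) = ennreal (\<Sum>i<N. expectation (\<lambda>\<omega>. (Y i \<omega>)\<^sup>2))"
      using nn_integral_eq_integral[OF *(1)] *(2) by simp
    also have "\<dots> \<le> ennreal (\<Sum>i. v i)"
      by (intro ennreal_leI order_trans[OF sum_mono sum_le_suminf] var v0) auto
    finally show "(\<integral>\<^sup>+\<omega>. ennreal ((\<Sum>i<N. Y i \<omega>)\<^sup>2) \<partial>M) \<le> ennreal (\<Sum>i. v i)" .
  qed
  also have "\<dots> = ennreal (\<Sum>i. v i)" by (simp add: Liminf_const)
  finally have le: "(\<integral>\<^sup>+\<omega>. ennreal ((\<Sum>i. Y i \<omega>)\<^sup>2) \<partial>M) \<le> ennreal (\<Sum>i. v i)" .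
  have i2: "integrable M (\<lambda>\<omega>. (\<Sum>i. Y i \<omega>)\<^sup>2)"
    by (rule integrableI_bounded) (use le in \<open>auto intro: le_less_trans\<close>)
  have E: "expectation (\<lambda>\<omega>. (\<Sum>i. Y i \<omega>)\<^sup>2) \<le> (\<Sum>i. v i)"
    using le nn_integral_eq_integral[OF i2] suminf_nonneg[OF var(2) v0] by (simp add: ennreal_le_iff)
  have "{\<omega> \<in> space M. \<epsilon> \<le> \<bar>\<Sum>i. Y i \<omega>\<bar>} = {\<omega> \<in> space M. \<epsilon>\<^sup>2 \<le> (\<Sum>i. Y i \<omega>)\<^sup>2}"
    using \<open>0 < \<epsilon>\<close> by (auto simp: abs_le_square_iff[symmetric])
  also have "prob \<dots> \<le> expectation (\<lambda>\<omega>. (\<Sum>i. Y i \<omega>)\<^sup>2) / \<epsilon>\<^sup>2"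
    by (rule integral_Markov_inequality_measure[OF i2, where A="{}"]) (use \<open>0 < \<epsilon>\<close> in auto)
  also have "\<dots> \<le> (\<Sum>i. v i) / \<epsilon>\<^sup>2"
    using E by (intro divide_right_mono) auto
  finally show ?thesis .
qed

section \<open>Gaussian smoothing and the centred chi-square law\<close>

text \<open>The integrand times the standard normal density is, up to a constant, the density of a
  centred normal law with variance \<open>1 / (1 + u\<^sup>2)\<close>.\<close>

lemma normal_smoothing_integral:
  "integrable std_normal_distribution (\<lambda>g. exp (- (u * g)\<^sup>2 / 2)) \<and>
   (LINT g|std_normal_distribution. exp (- (u * g)\<^sup>2 / 2)) = 1 / sqrt (1 + u\<^sup>2)"
proof -
  define s where "s = 1 / sqrt (1 + u\<^sup>2)"
  have s: "0 < s" "s\<^sup>2 = 1 / (1 + u\<^sup>2)" by (auto simp: s_def add_pos_nonneg power_divide)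
  have p: "0 < 1 + u\<^sup>2" by (simp add: add_pos_nonneg)
  have eq: "std_normal_density g * exp (- (u * g)\<^sup>2 / 2) = s * normal_density 0 s g" for g
  proof -
    have "sqrt (2 * pi * s\<^sup>2) = sqrt (2 * pi) * s"
      using s(1) by (simp add: real_sqrt_mult)
    moreover have "- g\<^sup>2 / (2 * s\<^sup>2) = - g\<^sup>2 / 2 + - (u * g)\<^sup>2 / 2"
      using p by (simp add: s(2) field_simps power_mult_distrib)
    ultimately show ?thesis
      using s(1) by (simp add: normal_density_def exp_add[symmetric])
  qed
  show ?thesis
    using s(1) by (simp add: integral_density integrable_density normal_density_nonneg eq[simplified] flip: s_def)
qed


definition centred_chisq :: "real measure" where
  "centred_chisq = distr std_normal_distribution borel (\<lambda>x. x\<^sup>2 - 1)"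

lemma integrable_std_normal_chisq_power:
  "integrable std_normal_distribution (\<lambda>x. (x\<^sup>2 - 1) ^ k)"
proof -
  have "(\<lambda>x::real. (x\<^sup>2 - 1) ^ k) = (\<lambda>x. \<Sum>i\<le>k. of_nat (k choose i) * x ^ (2 * i) * (- 1) ^ (k - i))"
    using binomial_ring[of "_\<^sup>2" "- 1::real" k] by (simp add: fun_eq_iff power_mult)
  then show ?thesis
    by (auto intro!: integrable_std_normal_distribution_moment)
qed

lemma std_normal_chisq_moments:
  "(LINT x|std_normal_distribution. x\<^sup>2 - 1) = 0"
  "(LINT x|std_normal_distribution. (x\<^sup>2 - 1)\<^sup>2) = 2"
proof -
  interpret real_distribution std_normal_distribution by (rule real_dist_normal_dist)
  have m: "(LINT x|std_normal_distribution. x\<^sup>2) = 1" "(LINT x|std_normal_distribution. x ^ 4) = 3"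
    using std_normal_distribution_even_moments(1)[of 1] std_normal_distribution_even_moments(1)[of 2]
    by (simp_all add: fact_numeral)
  note i = integrable_std_normal_distribution_moment
  show "(LINT x|std_normal_distribution. x\<^sup>2 - 1) = 0"
    using m i[of 2] by (simp add: prob_space[simplified])
  have "(\<lambda>x::real. (x\<^sup>2 - 1)\<^sup>2) = (\<lambda>x. x ^ 4 - 2 * x\<^sup>2 + 1)"
    by (simp add: fun_eq_iff power2_diff flip: power_mult)
  then show "(LINT x|std_normal_distribution. (x\<^sup>2 - 1)\<^sup>2) = 2"
    using m i[of 2] i[of 4] by (simp add: prob_space[simplified])
qed

text \<open>
  A second order Taylor expansion of the characteristic function: the law has mean 0, variance 2
  and a finite third absolute moment, so the value at \<open>s\<close> is \<open>1 - s\<^sup>2 + O(\<bar>s\<bar>\<^sup>3)\<close>. Giving away half of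
  the quadratic term absorbs the error near 0, and \<open>1 - s\<^sup>2 / 2 \<le> exp (- s\<^sup>2 / 2)\<close>.
\<close>

lemma char_centred_chisq_decay:
  "\<exists>s0>0. \<forall>s. \<bar>s\<bar> \<le> s0 \<longrightarrow> cmod (char centred_chisq s) \<le> exp (- s\<^sup>2 / 2)"
proof -
  interpret real_distribution std_normal_distribution by (rule real_dist_normal_dist)
  define X :: "real \<Rightarrow> real" where "X x = x\<^sup>2 - 1" for x
  have [measurable]: "X \<in> borel_measurable borel" by (simp add: X_def[abs_def])
  have int: "integrable std_normal_distribution (\<lambda>x. X x ^ k)" for k
    unfolding X_def by (rule integrable_std_normal_chisq_power)
  have iX: "integrable std_normal_distribution X"
    using int[of 1] by simp
  have i3: "integrable std_normal_distribution (\<lambda>x. \<bar>X x\<bar> ^ 3)"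
    using integrable_abs[OF int[of 3]] by (simp add: power_abs)
  have E: "expectation X = 0" "expectation (\<lambda>x. (X x)\<^sup>2) = 2"
    using std_normal_chisq_moments by (simp_all add: X_def[abs_def])
  define K where "K = expectation (\<lambda>x. \<bar>X x\<bar> ^ 3)"
  have K0: "0 \<le> K" unfolding K_def by simp
  have approx: "cmod (char centred_chisq s - (1 - s\<^sup>2)) \<le> s\<^sup>2 / 6 * (\<bar>s\<bar> * K)" for s
  proof -
    have "cmod (char centred_chisq s - (1 - s\<^sup>2 * 2 / 2))
        \<le> s\<^sup>2 / 6 * expectation (\<lambda>x. min (6 * (X x)\<^sup>2) (\<bar>s\<bar> * \<bar>X x\<bar> ^ 3))"
      using char_approx3'[of X 2 centred_chisq s] iX int[of 2] E
      by (simp add: centred_chisq_def X_def[abs_def])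
    also have "expectation (\<lambda>x. min (6 * (X x)\<^sup>2) (\<bar>s\<bar> * \<bar>X x\<bar> ^ 3)) \<le> expectation (\<lambda>x. \<bar>s\<bar> * \<bar>X x\<bar> ^ 3)"
      using int[of 2] i3 by (intro integral_mono) auto
    finally show ?thesis
      by (simp add: K_def mult_left_mono)
  qed
  \<comment> \<open>chosen so that the cubic error \<open>K \<bar>s\<bar>\<^sup>3 / 6\<close> is at most \<open>s\<^sup>2 / 2\<close>\<close>
  define s0 where "s0 = min 1 (3 / (K + 1))"
  have s0: "0 < s0" "s0 \<le> 1" "s0 * K \<le> 3"
    using K0 by (auto simp: s0_def min_def field_simps)
  have "cmod (char centred_chisq s) \<le> exp (- s\<^sup>2 / 2)" if "\<bar>s\<bar> \<le> s0" for s
  proof -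
    have s1: "s\<^sup>2 \<le> 1"
      using that s0(2) by (simp add: abs_square_le_1)
    have "\<bar>s\<bar> * K \<le> 3"
      using that s0(3) K0 by (meson mult_right_mono order_trans)
    then have *: "s\<^sup>2 / 6 * (\<bar>s\<bar> * K) \<le> s\<^sup>2 / 6 * 3"
      by (intro mult_left_mono) auto
    have "cmod (char centred_chisq s) \<le> cmod (1 - s\<^sup>2) + cmod (char centred_chisq s - (1 - s\<^sup>2))"
      by (metis add.commute diff_add_cancel norm_triangle_ineq)
    also have "cmod (1 - s\<^sup>2) = \<bar>1 - s\<^sup>2\<bar>"
      by (metis norm_of_real of_real_1 of_real_diff)
    also have "\<bar>1 - s\<^sup>2\<bar> = 1 - s\<^sup>2"
      using s1 by simp
    also have "1 - s\<^sup>2 + cmod (char centred_chisq s - (1 - s\<^sup>2)) \<le> 1 + - s\<^sup>2 / 2"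
      using order_trans[OF approx[of s] *] by linarith
    finally have "cmod (char centred_chisq s) \<le> 1 + - s\<^sup>2 / 2" .

    also have "1 + - s\<^sup>2 / 2 \<le> exp (- s\<^sup>2 / 2)"
      by (rule exp_ge_add_one_self)
    finally show ?thesis .
  qed
  with s0(1) show ?thesis by blast
qed

text \<open>
  The Gaussian kernel \<open>exp (- y\<^sup>2 / 2)\<close> is itself the characteristic function of the standard normal
  law. Writing it as an integral of \<open>iexp (g y)\<close> over a normal frequency \<open>g\<close> and exchanging the
  integrals expresses the kernel average of \<open>X\<close> around \<open>x\<close> by the characteristic function of \<open>X\<close>;
  taking absolute values makes the bound uniform in \<open>x\<close>.
\<close>

lemma (in prob_space) gaussian_smoothing_le_char:
  fixes X :: "'a \<Rightarrow> real"
  assumes [measurable]: "X \<in> borel_measurable M"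
  shows "expectation (\<lambda>\<omega>. exp (- ((X \<omega> - x) / \<delta>)\<^sup>2 / 2))
    \<le> (LINT g|std_normal_distribution. cmod (char (distr M borel X) (g / \<delta>)))"
proof -
  interpret N: real_distribution std_normal_distribution by (rule real_dist_normal_dist)
  interpret P: pair_prob_space M std_normal_distribution ..
  define F where "F = (\<lambda>\<omega> g. iexp (g * ((X \<omega> - x) / \<delta>)))"
  have [measurable]: "case_prod F \<in> borel_measurable (M \<Otimes>\<^sub>M std_normal_distribution)"
    unfolding F_def by measurable
  have intF: "integrable (M \<Otimes>\<^sub>M std_normal_distribution) (case_prod F)"
    by (rule P.integrable_const_bound[where B=1]) (auto simp: F_def)
  have 1: "(LINT g|std_normal_distribution. F \<omega> g) = complex_of_real (exp (- ((X \<omega> - x) / \<delta>)\<^sup>2 / 2))" for \<omega>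
    using fun_cong[OF char_std_normal_distribution, of "(X \<omega> - x) / \<delta>"]
    by (simp add: char_def F_def mult_ac)
  have 2: "(LINT \<omega>|M. F \<omega> g) = iexp (- g * x / \<delta>) * char (distr M borel X) (g / \<delta>)" for g
  proof -
    have "F \<omega> g = iexp (- g * x / \<delta>) * iexp (g / \<delta> * X \<omega>)" for \<omega>
      unfolding F_def mult_exp_exp by (rule arg_cong[of _ _ exp]) (simp add: algebra_simps diff_divide_distrib)
    then show ?thesis
      by (simp add: char_def integral_distr)
  qed
  have "complex_of_real (expectation (\<lambda>\<omega>. exp (- ((X \<omega> - x) / \<delta>)\<^sup>2 / 2)))
      = (LINT \<omega>|M. LINT g|std_normal_distribution. F \<omega> g)"
    by (simp only: 1 integral_complex_of_real)
  also have "\<dots> = (LINT g|std_normal_distribution. LINT \<omega>|M. F \<omega> g)"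
    by (rule P.Fubini_integral[symmetric, OF intF])
  also have "\<dots> = (LINT g|std_normal_distribution. iexp (- g * x / \<delta>) * char (distr M borel X) (g / \<delta>))"
    by (simp only: 2)
  finally have eq: "complex_of_real (expectation (\<lambda>\<omega>. exp (- ((X \<omega> - x) / \<delta>)\<^sup>2 / 2)))
      = (LINT g|std_normal_distribution. iexp (- g * x / \<delta>) * char (distr M borel X) (g / \<delta>))" .
  have "\<bar>expectation (\<lambda>\<omega>. exp (- ((X \<omega> - x) / \<delta>)\<^sup>2 / 2))\<bar>
      = cmod (LINT g|std_normal_distribution. iexp (- g * x / \<delta>) * char (distr M borel X) (g / \<delta>))"
    unfolding eq[symmetric] norm_of_real ..
  also have "\<dots> \<le> (LINT g|std_normal_distribution. cmod (iexp (- g * x / \<delta>) * char (distr M borel X) (g / \<delta>)))"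
    by (rule integral_norm_bound)
  also have "\<dots> = (LINT g|std_normal_distribution. cmod (char (distr M borel X) (g / \<delta>)))"
    by (simp add: norm_mult)
  finally show ?thesis by simp
qed


section \<open>Weighted sums of shifted Gaussian squares\<close>

definition centred_quad :: "(nat \<Rightarrow> real) \<Rightarrow> (nat \<Rightarrow> real) \<Rightarrow> real" where
  "centred_quad a z = (\<Sum>j. a j * ((z j)\<^sup>2 - 1))"

locale gaussian_sequence = prob_space M for M :: "'a measure" +
  fixes \<xi> :: "nat \<Rightarrow> 'a \<Rightarrow> real"
  assumes indep: "indep_vars (\<lambda>_. borel) \<xi> UNIV"
    and normal: "\<And>j. distributed M lborel (\<xi> j) std_normal_density"
begin

lemma measurable_xi [measurable]: "\<xi> j \<in> borel_measurable M"
  using distributed_measurable[OF normal] by simp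

lemma distr_xi: "distr M borel (\<xi> j) = std_normal_distribution"
proof -
  have "distr M borel (\<xi> j) = distr M lborel (\<xi> j)"
    by (rule distr_cong) simp_all
  then show ?thesis
    using distributed_distr_eq_density[OF normal] by simp
qed

lemma expectation_xi:
  fixes g :: "real \<Rightarrow> 'b::{banach, second_countable_topology}"
  assumes [measurable]: "g \<in> borel_measurable borel"
  shows "expectation (\<lambda>\<omega>. g (\<xi> j \<omega>)) = (LINT x|std_normal_distribution. g x)"
    and "integrable M (\<lambda>\<omega>. g (\<xi> j \<omega>)) \<longleftrightarrow> integrable std_normal_distribution g"
  by (simp_all add: integral_distr integrable_distr_eq flip: distr_xi[of j])

text \<open>The expectation of the series is \<open>\<Sum> a\<^sub>j\<close>, so the series is finite almost surely.\<close>

lemma AE_summable_weighted_squares: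
  assumes "\<And>j. 0 \<le> a j" "summable a"
  shows "AE \<omega> in M. summable (\<lambda>j. a j * (\<xi> j \<omega>)\<^sup>2)"
proof -
  have int: "integrable M (\<lambda>\<omega>. (\<xi> j \<omega>)\<^sup>2)" for j
    using expectation_xi(2)[of "\<lambda>x. x\<^sup>2" j] integrable_std_normal_distribution_moment[of 2] by simp
  have E: "expectation (\<lambda>\<omega>. (\<xi> j \<omega>)\<^sup>2) = 1" for j
    using expectation_xi(1)[of "\<lambda>x. x\<^sup>2" j] std_normal_distribution_even_moments(1)[of 1] by simp
  have 1: "(\<integral>\<^sup>+\<omega>. ennreal (a j * (\<xi> j \<omega>)\<^sup>2) \<partial>M) = ennreal (a j)" for j
    using assms(1)[of j] int[of j] E[of j] by (subst nn_integral_eq_integral) auto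
  have "(\<integral>\<^sup>+\<omega>. (\<Sum>j. ennreal (a j * (\<xi> j \<omega>)\<^sup>2)) \<partial>M) = (\<Sum>j. ennreal (a j))"
    by (subst nn_integral_suminf) (auto simp: 1)
  also have "\<dots> = ennreal (\<Sum>j. a j)"
    by (rule suminf_ennreal2) (use assms in auto)
  finally have "AE \<omega> in M. (\<Sum>j. ennreal (a j * (\<xi> j \<omega>)\<^sup>2)) \<noteq> \<infinity>"
    by (intro nn_integral_PInf_AE) auto
  then show ?thesis
    by eventually_elim (rule summable_suminf_not_top, use assms(1) in auto)
qed

text \<open>
  Expanding the squares. The linear series converges absolutely because
  \<open>2 \<bar>b\<^sub>j \<xi>\<^sub>j\<bar> \<le> b\<^sub>j\<^sup>2 + \<xi>\<^sub>j\<^sup>2\<close>; this is needed to split the sum.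
\<close>

lemma centred_quad_shift:
  assumes "\<And>j. 0 \<le> a j" "summable a" "summable (\<lambda>j. a j * (b j)\<^sup>2)"
  shows "AE \<omega> in M. summable (\<lambda>j. 2 * a j * b j * \<xi> j \<omega>) \<and>
    centred_quad a (\<lambda>j. \<xi> j \<omega> + b j) =
      centred_quad a (\<lambda>j. \<xi> j \<omega>) + (\<Sum>j. a j * (b j)\<^sup>2) + (\<Sum>j. 2 * a j * b j * \<xi> j \<omega>)"
  using AE_summable_weighted_squares[OF assms(1,2)]
proof eventually_elim
  case (elim \<omega>)
  have lin: "summable (\<lambda>j. 2 * a j * b j * \<xi> j \<omega>)"
  proof (rule summable_comparison_test')
    show "summable (\<lambda>j. a j * (b j)\<^sup>2 + a j * (\<xi> j \<omega>)\<^sup>2)"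
      using assms(3) elim by (rule summable_add)
    fix j
    have "2 * \<bar>b j * \<xi> j \<omega>\<bar> \<le> (b j)\<^sup>2 + (\<xi> j \<omega>)\<^sup>2"
      using sum_squares_bound[of "\<bar>b j\<bar>" "\<bar>\<xi> j \<omega>\<bar>"] by (simp add: abs_mult mult.assoc)
    from mult_left_mono[OF this assms(1)[of j]]
    show "norm (2 * a j * b j * \<xi> j \<omega>) \<le> a j * (b j)\<^sup>2 + a j * (\<xi> j \<omega>)\<^sup>2"
      using assms(1)[of j] by (simp add: abs_mult algebra_simps)
  qed
  have c: "summable (\<lambda>j. a j * ((\<xi> j \<omega>)\<^sup>2 - 1))"
    using summable_diff[OF elim assms(2)] by (simp add: algebra_simps)
  have "centred_quad a (\<lambda>j. \<xi> j \<omega> + b j) =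
      (\<Sum>j. a j * ((\<xi> j \<omega>)\<^sup>2 - 1) + a j * (b j)\<^sup>2 + 2 * a j * b j * \<xi> j \<omega>)"
    unfolding centred_quad_def by (rule arg_cong[of _ _ suminf]) (simp add: fun_eq_iff power2_sum algebra_simps)
  also have "\<dots> = centred_quad a (\<lambda>j. \<xi> j \<omega>) + (\<Sum>j. a j * (b j)\<^sup>2) + (\<Sum>j. 2 * a j * b j * \<xi> j \<omega>)"
    unfolding centred_quad_def using c assms(3) lin
    by (simp add: suminf_add[symmetric] summable_add)
  finally show ?case using lin by simp
qed

lemma indep_transform:
  assumes "\<And>j. g j \<in> borel_measurable borel"
  shows "indep_vars (\<lambda>_. borel) (\<lambda>j \<omega>. g j (\<xi> j \<omega>)) UNIV"
  by (rule indep_vars_compose2[OF indep]) (use assms in auto)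

text \<open>The variance of the linear term is \<open>4 \<Sum> a\<^sub>j\<^sup>2 b\<^sub>j\<^sup>2\<close>, which one factor \<open>a\<^sub>j \<le> m\<close> reduces to the
  shift itself.\<close>

lemma linear_term_tail:
  assumes a: "\<And>j. 0 \<le> a j" "\<And>j. a j \<le> m" "summable a" and b: "summable (\<lambda>j. a j * (b j)\<^sup>2)"
    and "0 < \<epsilon>"
  shows "prob {\<omega> \<in> space M. \<epsilon> \<le> \<bar>\<Sum>j. 2 * a j * b j * \<xi> j \<omega>\<bar>} \<le> 4 * m * (\<Sum>j. a j * (b j)\<^sup>2) / \<epsilon>\<^sup>2"
proof -
  have id: "integrable M (\<xi> j)" "expectation (\<xi> j) = 0" for j
    using expectation_xi[of "\<lambda>x. x" j] integrable_std_normal_distribution_moment[of 1]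
      integral_std_normal_distribution_moment_odd[of 1] by simp_all
  have sq: "integrable M (\<lambda>\<omega>. (\<xi> j \<omega>)\<^sup>2)" "expectation (\<lambda>\<omega>. (\<xi> j \<omega>)\<^sup>2) = 1" for j
    using expectation_xi[of "\<lambda>x. x\<^sup>2" j] integrable_std_normal_distribution_moment[of 2]
      std_normal_distribution_even_moments(1)[of 1] by simp_all
  have "prob {\<omega> \<in> space M. \<epsilon> \<le> \<bar>\<Sum>j. 2 * a j * b j * \<xi> j \<omega>\<bar>} \<le> (\<Sum>j. 4 * m * (a j * (b j)\<^sup>2)) / \<epsilon>\<^sup>2"
  proof (rule indep_series_tail)
    show "indep_vars (\<lambda>_. borel) (\<lambda>j \<omega>. 2 * a j * b j * \<xi> j \<omega>) UNIV"
      by (rule indep_transform) simp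
    show "AE \<omega> in M. summable (\<lambda>j. 2 * a j * b j * \<xi> j \<omega>)"
      using centred_quad_shift[OF a(1,3) b] by eventually_elim simp
    show "summable (\<lambda>j. 4 * m * (a j * (b j)\<^sup>2))"
      using b by (rule summable_mult)
    show "expectation (\<lambda>\<omega>. (2 * a j * b j * \<xi> j \<omega>)\<^sup>2) \<le> 4 * m * (a j * (b j)\<^sup>2)" for j
    proof -
      have "a j * (a j * (b j)\<^sup>2) \<le> m * (a j * (b j)\<^sup>2)"
        using a(1,2) by (intro mult_right_mono) auto
      then show ?thesis
        using sq by (simp add: power_mult_distrib) (simp add: power2_eq_square mult_ac)
    qed
  qed (use id sq \<open>0 < \<epsilon>\<close> in \<open>auto simp: power_mult_distrib\<close>)
  then show ?thesis
    using b by (simp add: suminf_mult)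
qed

lemma centred_quad_tail:
  assumes a: "\<And>j. 0 \<le> a j" "summable a" "summable (\<lambda>j. (a j)\<^sup>2)" and "0 < R"
  shows "prob {\<omega> \<in> space M. R \<le> \<bar>centred_quad a (\<lambda>j. \<xi> j \<omega>)\<bar>} \<le> 2 * (\<Sum>j. (a j)\<^sup>2) / R\<^sup>2"
proof -
  have id: "integrable M (\<lambda>\<omega>. (\<xi> j \<omega>)\<^sup>2 - 1)" "expectation (\<lambda>\<omega>. (\<xi> j \<omega>)\<^sup>2 - 1) = 0" for j
    using expectation_xi[of "\<lambda>x. x\<^sup>2 - 1" j] integrable_std_normal_chisq_power[of 1]
      std_normal_chisq_moments by simp_all
  have sq: "integrable M (\<lambda>\<omega>. ((\<xi> j \<omega>)\<^sup>2 - 1)\<^sup>2)" "expectation (\<lambda>\<omega>. ((\<xi> j \<omega>)\<^sup>2 - 1)\<^sup>2) = 2" for j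
    using expectation_xi[of "\<lambda>x. (x\<^sup>2 - 1)\<^sup>2" j] integrable_std_normal_chisq_power[of 2]
      std_normal_chisq_moments by simp_all
  have "prob {\<omega> \<in> space M. R \<le> \<bar>\<Sum>j. a j * ((\<xi> j \<omega>)\<^sup>2 - 1)\<bar>} \<le> (\<Sum>j. 2 * (a j)\<^sup>2) / R\<^sup>2"
  proof (rule indep_series_tail)
    show "indep_vars (\<lambda>_. borel) (\<lambda>j \<omega>. a j * ((\<xi> j \<omega>)\<^sup>2 - 1)) UNIV"
      by (rule indep_transform) simp
    show "AE \<omega> in M. summable (\<lambda>j. a j * ((\<xi> j \<omega>)\<^sup>2 - 1))"
      using AE_summable_weighted_squares[OF a(1,2)]
    proof eventually_elim
      case (elim \<omega>)
      from summable_diff[OF elim a(2)] show ?case by (simp add: algebra_simps)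
    qed
    show "summable (\<lambda>j. 2 * (a j)\<^sup>2)"
      using a(3) by (rule summable_mult)
  qed (use id sq \<open>0 < R\<close> in \<open>auto simp: power_mult_distrib simp del: Bochner_Integration.integral_diff\<close>)
  then show ?thesis
    using a(3) by (simp add: suminf_mult centred_quad_def)
qed

text \<open>
  The characteristic function of a partial sum factorises, and each factor \<open>j\<close> is evaluated at
  \<open>t a\<^sub>j\<close>. For \<open>m \<bar>t\<bar> \<le> s0\<close> all these arguments are in the range of Gaussian decay. For larger \<open>t\<close>
  the added term exceeds 1, hence the trivial bound; having it in this form gives one estimate for
  all frequencies that is easy to integrate.
\<close>

lemma char_partial_quad_le:
  assumes decay: "0 < s0" "\<And>s. \<bar>s\<bar> \<le> s0 \<Longrightarrow> cmod (char centred_chisq s) \<le> exp (- s\<^sup>2 / 2)"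
    and a: "\<And>j. 0 \<le> a j" "\<And>j. a j \<le> m"
  shows "cmod (char (distr M borel (\<lambda>\<omega>. \<Sum>j<N. a j * ((\<xi> j \<omega>)\<^sup>2 - 1))) t)
    \<le> exp (- (sqrt (\<Sum>j<N. (a j)\<^sup>2) * t)\<^sup>2 / 2) + (m * t / s0)\<^sup>2"
proof (cases "m * \<bar>t\<bar> \<le> s0")
  case True
  have single: "char (distr M borel (\<lambda>\<omega>. a j * ((\<xi> j \<omega>)\<^sup>2 - 1))) t = char centred_chisq (t * a j)" for j
  proof -
    have "char (distr M borel (\<lambda>\<omega>. a j * ((\<xi> j \<omega>)\<^sup>2 - 1))) t
        = expectation (\<lambda>\<omega>. (\<lambda>x. iexp (t * (a j * (x\<^sup>2 - 1)))) (\<xi> j \<omega>))"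
      by (simp add: char_def integral_distr)
    also have "\<dots> = (LINT x|std_normal_distribution. iexp (t * (a j * (x\<^sup>2 - 1))))"
      by (rule expectation_xi(1)) measurable
    also have "\<dots> = char centred_chisq (t * a j)"
      by (simp add: char_def centred_chisq_def integral_distr mult_ac)
    finally show ?thesis .
  qed
  have "char (distr M borel (\<lambda>\<omega>. \<Sum>j<N. a j * ((\<xi> j \<omega>)\<^sup>2 - 1))) t
      = (\<Prod>j<N. char (distr M borel (\<lambda>\<omega>. a j * ((\<xi> j \<omega>)\<^sup>2 - 1))) t)"
    by (rule char_distr_sum) (rule indep_vars_subset[OF indep_transform], auto)
  then have "cmod (char (distr M borel (\<lambda>\<omega>. \<Sum>j<N. a j * ((\<xi> j \<omega>)\<^sup>2 - 1))) t)
      = (\<Prod>j<N. cmod (char centred_chisq (t * a j)))"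
    by (simp add: single prod_norm)
  also have "\<dots> \<le> (\<Prod>j<N. exp (- (t * a j)\<^sup>2 / 2))"
  proof (intro prod_mono conjI decay(2))
    fix j
    have "\<bar>t\<bar> * a j \<le> \<bar>t\<bar> * m" using a(2) by (intro mult_left_mono) auto
    then show "\<bar>t * a j\<bar> \<le> s0" using True a(1)[of j] by (simp add: abs_mult mult.commute)
  qed simp
  also have "\<dots> = exp (- (sqrt (\<Sum>j<N. (a j)\<^sup>2) * t)\<^sup>2 / 2)"
    by (simp add: exp_sum[symmetric] power_mult_distrib sum_nonneg sum_negf sum_divide_distrib[symmetric]
        sum_distrib_left[symmetric] mult.commute)
  also have "\<dots> \<le> \<dots> + (m * t / s0)\<^sup>2" by simp
  finally show ?thesis .
next
  case False
  interpret D: real_distribution "distr M borel (\<lambda>\<omega>. \<Sum>j<N. a j * ((\<xi> j \<omega>)\<^sup>2 - 1))"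
    by (rule real_distribution_distr) measurable
  have "0 \<le> m" using a order_trans by blast
  then have "1 \<le> \<bar>m * t / s0\<bar>" using False decay(1) by (simp add: abs_mult field_simps)
  then have "1 \<le> (m * t / s0)\<^sup>2" by (metis abs_le_square_iff abs_one one_power2)
  then show ?thesis
    using D.cmod_char_le_1[of t] by (smt (verit) exp_ge_zero)
qed

text \<open>
  Gaussian smoothing at scale \<open>\<delta>\<close> applied to the partial sums, followed by dominated convergence
  and Markov's inequality for the kernel, which is at least \<open>exp (- 1/2)\<close> on the interval. For small
  \<open>m\<close> the bound is of order \<open>\<delta>\<close>, whatever the centre \<open>x\<close>.
\<close>

lemma centred_quad_concentration:
  assumes decay: "0 < s0" "\<And>s. \<bar>s\<bar> \<le> s0 \<Longrightarrow> cmod (char centred_chisq s) \<le> exp (- s\<^sup>2 / 2)"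
    and a: "\<And>j. 0 \<le> a j" "\<And>j. a j \<le> m" "summable a" "summable (\<lambda>j. (a j)\<^sup>2)"
    and pos: "0 < (\<Sum>j. (a j)\<^sup>2)" and \<delta>: "0 < \<delta>"
  shows "prob {\<omega> \<in> space M. \<bar>centred_quad a (\<lambda>j. \<xi> j \<omega>) - x\<bar> \<le> \<delta>}
    \<le> exp (1/2) * (\<delta> / sqrt (\<Sum>j. (a j)\<^sup>2) + (m / (\<delta> * s0))\<^sup>2)"
proof -
  define S where "S N = (\<Sum>j<N. (a j)\<^sup>2)" for N
  define Z where "Z N \<omega> = (\<Sum>j<N. a j * ((\<xi> j \<omega>)\<^sup>2 - 1))" for N \<omega>
  define U where "U \<omega> = centred_quad a (\<lambda>j. \<xi> j \<omega>)" for \<omega>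
  define G where "G z = exp (- ((z - x) / \<delta>)\<^sup>2 / 2)" for z
  have [measurable]: "Z N \<in> borel_measurable M" "U \<in> borel_measurable M" "G \<in> borel_measurable borel" for N
    unfolding Z_def[abs_def] U_def[abs_def] centred_quad_def G_def[abs_def] by measurable
  interpret N: real_distribution std_normal_distribution by (rule real_dist_normal_dist)
  have step: "expectation (\<lambda>\<omega>. G (Z N \<omega>)) \<le> 1 / sqrt (1 + (sqrt (S N) / \<delta>)\<^sup>2) + (m / (\<delta> * s0))\<^sup>2" for N
  proof -
    interpret D: real_distribution "distr M borel (Z N)"
      by (rule real_distribution_distr) measurable
    have sq: "(LINT g|std_normal_distribution. g\<^sup>2) = 1" "integrable std_normal_distribution (\<lambda>g. g\<^sup>2)"
      using std_normal_distribution_even_moments[of 1] by simp_all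
    have "expectation (\<lambda>\<omega>. G (Z N \<omega>))
        \<le> (LINT g|std_normal_distribution. cmod (char (distr M borel (Z N)) (g / \<delta>)))"
      unfolding G_def by (rule gaussian_smoothing_le_char) measurable
    also have "\<dots> \<le> (LINT g|std_normal_distribution. exp (- (sqrt (S N) / \<delta> * g)\<^sup>2 / 2) + (m / (\<delta> * s0))\<^sup>2 * g\<^sup>2)"
    proof (rule integral_mono)
      show "integrable std_normal_distribution (\<lambda>g. cmod (char (distr M borel (Z N)) (g / \<delta>)))"
        by (rule N.integrable_const_bound[where B=1]) (auto simp: D.cmod_char_le_1)
      show "integrable std_normal_distribution
          (\<lambda>g. exp (- (sqrt (S N) / \<delta> * g)\<^sup>2 / 2) + (m / (\<delta> * s0))\<^sup>2 * g\<^sup>2)"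
        by (intro Bochner_Integration.integrable_add integrable_mult_right sq(2)
            normal_smoothing_integral[THEN conjunct1])
      fix g
      show "cmod (char (distr M borel (Z N)) (g / \<delta>))
          \<le> exp (- (sqrt (S N) / \<delta> * g)\<^sup>2 / 2) + (m / (\<delta> * s0))\<^sup>2 * g\<^sup>2"
        using char_partial_quad_le[OF decay a(1,2), where N=N and t="g / \<delta>"]
        by (simp add: Z_def[abs_def] S_def power_mult_distrib power_divide mult_ac)
    qed
    also have "\<dots> = 1 / sqrt (1 + (sqrt (S N) / \<delta>)\<^sup>2) + (m / (\<delta> * s0))\<^sup>2"
      by (subst Bochner_Integration.integral_add)
        (auto simp only: normal_smoothing_integral integral_mult_right_zero sq mult_1_right
          intro!: integrable_mult_right)
    finally show ?thesis .
  qed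
  have conv: "AE \<omega> in M. (\<lambda>N. Z N \<omega>) \<longlonglongrightarrow> U \<omega>"
    using AE_summable_weighted_squares[OF a(1,3)]
  proof eventually_elim
    case (elim \<omega>)
    have "summable (\<lambda>j. a j * ((\<xi> j \<omega>)\<^sup>2 - 1))"
      using summable_diff[OF elim a(3)] by (simp add: algebra_simps)
    then show ?case
      unfolding Z_def U_def centred_quad_def by (rule summable_LIMSEQ)
  qed
  have lim: "(\<lambda>N. expectation (\<lambda>\<omega>. G (Z N \<omega>))) \<longlonglongrightarrow> expectation (\<lambda>\<omega>. G (U \<omega>))"
  proof (rule integral_dominated_convergence[where w="\<lambda>_. 1"])
    show "AE \<omega> in M. (\<lambda>N. G (Z N \<omega>)) \<longlonglongrightarrow> G (U \<omega>)"
      using conv by eventually_elim (auto simp: G_def intro!: tendsto_intros \<delta>[THEN less_imp_neq, symmetric])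
  qed (auto simp: G_def)
  define V where "V = (\<Sum>j. (a j)\<^sup>2)"
  have V: "0 < V" using pos by (simp add: V_def)
  have "S \<longlonglongrightarrow> V"
    unfolding S_def V_def using a(4) by (rule summable_LIMSEQ)
  then have rhs: "(\<lambda>N. 1 / sqrt (1 + (sqrt (S N) / \<delta>)\<^sup>2) + (m / (\<delta> * s0))\<^sup>2)
      \<longlonglongrightarrow> 1 / sqrt (1 + (sqrt V / \<delta>)\<^sup>2) + (m / (\<delta> * s0))\<^sup>2"
  proof (intro tendsto_intros)
    have "0 < 1 + (sqrt V / \<delta>)\<^sup>2" by (simp add: add_pos_nonneg)
    then show "sqrt (1 + (sqrt V / \<delta>)\<^sup>2) \<noteq> 0" by (metis less_numeral_extra(3) real_sqrt_gt_zero)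
  qed (use \<delta> in auto)
  have "expectation (\<lambda>\<omega>. G (U \<omega>)) \<le> 1 / sqrt (1 + (sqrt V / \<delta>)\<^sup>2) + (m / (\<delta> * s0))\<^sup>2"
    by (rule LIMSEQ_le[OF lim rhs]) (use step in blast)
  also have "1 / sqrt (1 + (sqrt V / \<delta>)\<^sup>2) \<le> \<delta> / sqrt V"
  proof -
    have "sqrt V / \<delta> \<le> sqrt (1 + (sqrt V / \<delta>)\<^sup>2)"
      by (rule real_le_rsqrt) simp
    moreover have "0 < sqrt V / \<delta>" using V \<delta> by simp
    ultimately have "1 / sqrt (1 + (sqrt V / \<delta>)\<^sup>2) \<le> 1 / (sqrt V / \<delta>)"
      by (intro frac_le) auto
    then show ?thesis by simp
  qed
  finally have E: "expectation (\<lambda>\<omega>. G (U \<omega>)) \<le> \<delta> / sqrt V + (m / (\<delta> * s0))\<^sup>2" by simp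
  have iG: "integrable M (\<lambda>\<omega>. G (U \<omega>))"
    by (rule integrable_const_bound[where B=1]) (auto simp: G_def)
  have "prob {\<omega> \<in> space M. \<bar>U \<omega> - x\<bar> \<le> \<delta>} \<le> prob {\<omega> \<in> space M. exp (- (1/2)) \<le> G (U \<omega>)}"
  proof (intro finite_measure_mono subsetI)
    fix \<omega> assume "\<omega> \<in> {\<omega> \<in> space M. \<bar>U \<omega> - x\<bar> \<le> \<delta>}"
    then have "\<omega> \<in> space M" "\<bar>(U \<omega> - x) / \<delta>\<bar> \<le> 1" using \<delta> by auto
    then show "\<omega> \<in> {\<omega> \<in> space M. exp (- (1/2)) \<le> G (U \<omega>)}"
      by (simp add: G_def abs_square_le_1)
  qed measurable
  also have "\<dots> \<le> expectation (\<lambda>\<omega>. G (U \<omega>)) / exp (- (1/2))"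
    by (rule integral_Markov_inequality_measure[OF iG, where A="{}"]) (auto simp: G_def)
  also have "\<dots> = exp (1/2) * expectation (\<lambda>\<omega>. G (U \<omega>))"
    by (simp add: exp_minus field_simps)
  also have "\<dots> \<le> exp (1/2) * (\<delta> / sqrt V + (m / (\<delta> * s0))\<^sup>2)"
    using E by simp
  finally show ?thesis unfolding U_def V_def .
qed

end


section \<open>Error probabilities of threshold tests\<close>

text \<open>Pigeonhole: at most \<open>2 R / \<delta> + 2\<close> half-open intervals of length \<open>\<delta>\<close> cover the part of the
  line that carries half of the mass, so one of them has at least the average share.\<close>

lemma (in prob_space) interval_of_mass:
  assumes [measurable]: "X \<in> borel_measurable M" and "0 < R" "0 < \<delta>"
    and tail: "prob {\<omega> \<in> space M. R \<le> \<bar>X \<omega>\<bar>} \<le> 1/2"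
  shows "\<exists>x. 1 / (2 * (2 * R / \<delta> + 2)) \<le> prob {\<omega> \<in> space M. x - \<delta> < X \<omega> \<and> X \<omega> \<le> x}"
proof (rule ccontr)
  assume none: "\<not> ?thesis"
  define K where "K = nat \<lfloor>2 * R / \<delta>\<rfloor> + 1"
  define I where "I i = {\<omega> \<in> space M. - R + real (Suc i) * \<delta> - \<delta> < X \<omega> \<and> X \<omega> \<le> - R + real (Suc i) * \<delta>}" for i
  have q: "0 < 2 * R / \<delta>" using assms(2,3) by simp
  have K: "real K \<le> 2 * R / \<delta> + 2" "2 * R / \<delta> < real K"
    using q unfolding K_def by linarith+
  have [measurable]: "I i \<in> events" for i unfolding I_def by measurable
  have less: "prob (I i) < 1 / (2 * (2 * R / \<delta> + 2))" for i
    using none unfolding I_def by (auto simp: not_le)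
  have cover: "{\<omega> \<in> space M. \<not> R \<le> \<bar>X \<omega>\<bar>} \<subseteq> (\<Union>i<K. I i)"
  proof
    fix \<omega> assume "\<omega> \<in> {\<omega> \<in> space M. \<not> R \<le> \<bar>X \<omega>\<bar>}"
    then have \<omega>: "\<omega> \<in> space M" "- R < X \<omega>" "X \<omega> < R" by auto
    define z where "z = (X \<omega> + R) / \<delta>"
    have z: "0 < z" "z < 2 * R / \<delta>"
      using \<omega> assms(3) by (auto simp: z_def divide_strict_right_mono)
    define i where "i = nat (\<lceil>z\<rceil> - 1)"
    have i: "real i < z" "z \<le> real (Suc i)"
      using z(1) unfolding i_def by linarith+
    have "X \<omega> = - R + z * \<delta>" using assms(3) by (simp add: z_def)
    moreover have "real i * \<delta> < z * \<delta>" "z * \<delta> \<le> real (Suc i) * \<delta>"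
      using i assms(3) by (auto intro: mult_strict_right_mono mult_right_mono simp del: of_nat_Suc)
    moreover have "i < K" using i z K by linarith
    ultimately show "\<omega> \<in> (\<Union>i<K. I i)"
      using \<omega>(1) by (intro UN_I[of i]) (auto simp: I_def algebra_simps)
  qed
  have "1/2 \<le> prob {\<omega> \<in> space M. \<not> R \<le> \<bar>X \<omega>\<bar>}"
    using tail by (subst prob_neg) auto
  also have "\<dots> \<le> prob (\<Union>i<K. I i)"
    by (intro finite_measure_mono cover) auto
  also have "\<dots> \<le> (\<Sum>i<K. prob (I i))"
    by (intro finite_measure_subadditive_finite) auto
  also have "\<dots> < (\<Sum>i<K. 1 / (2 * (2 * R / \<delta> + 2)))"
    by (intro sum_strict_mono less) (auto simp: K_def)
  also have "\<dots> = real K / (2 * R / \<delta> + 2) / 2" by simp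
  also have "\<dots> \<le> 1 / 2"
    using K(1) q by (intro divide_right_mono) (auto simp: divide_le_eq)
  finally show False by simp
qed

context gaussian_sequence
begin

lemma measurable_centred_quad [measurable]:
  "(\<lambda>\<omega>. centred_quad a (\<lambda>j. \<xi> j \<omega> + b j)) \<in> borel_measurable M"
  "(\<lambda>\<omega>. centred_quad a (\<lambda>j. \<xi> j \<omega>)) \<in> borel_measurable M"
  unfolding centred_quad_def by measurable

text \<open>Both errors are evaluated on the same noise, so that the two statistics can be compared
  pointwise; \<open>x\<close> is the threshold for the normalised statistic.\<close>

definition error_sum :: "(nat \<Rightarrow> real) \<Rightarrow> (nat \<Rightarrow> real) \<Rightarrow> real \<Rightarrow> real" where
  "error_sum a b x = prob {\<omega> \<in> space M. centred_quad a (\<lambda>j. \<xi> j \<omega>) > x} +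
     prob {\<omega> \<in> space M. \<not> centred_quad a (\<lambda>j. \<xi> j \<omega> + b j) > x}"

lemma AE_summable_shifted_squares:
  assumes "\<And>j. 0 \<le> a j" "summable a" "summable (\<lambda>j. a j * (b j)\<^sup>2)"
  shows "AE \<omega> in M. summable (\<lambda>j. a j * (\<xi> j \<omega> + b j)\<^sup>2)"
  using AE_summable_weighted_squares[OF assms(1,2)] centred_quad_shift[OF assms]
proof eventually_elim
  case (elim \<omega>)
  have "summable (\<lambda>j. a j * (\<xi> j \<omega>)\<^sup>2 + a j * (b j)\<^sup>2 + 2 * a j * b j * \<xi> j \<omega>)"
    using elim assms(3) by (intro summable_add) auto
  then show ?case by (simp add: power2_sum algebra_simps)
qed

text \<open>
  At a noise for which neither error occurs, \<open>U\<^sub>0 \<le> x < U\<^sub>b\<close>. As the shift is at most \<open>\<eta> / 2\<close>, then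
  either \<open>\<bar>L\<bar> \<ge> \<eta> / 2\<close> or \<open>U\<^sub>0\<close> is within \<open>\<eta>\<close> of \<open>x\<close>. The sum of the errors falls below 1 by no more
  than the probabilities of these two events.
\<close>

lemma error_sum_ge:
  assumes decay: "0 < s0" "\<And>s. \<bar>s\<bar> \<le> s0 \<Longrightarrow> cmod (char centred_chisq s) \<le> exp (- s\<^sup>2 / 2)"
    and a: "\<And>j. 0 \<le> a j" "\<And>j. a j \<le> m" "summable a" "summable (\<lambda>j. (a j)\<^sup>2)"
    and pos: "0 < (\<Sum>j. (a j)\<^sup>2)"
    and b: "summable (\<lambda>j. a j * (b j)\<^sup>2)"
    and \<eta>: "0 < \<eta>" "(\<Sum>j. a j * (b j)\<^sup>2) \<le> \<eta> / 2"
  shows "1 - exp (1/2) * (\<eta> / sqrt (\<Sum>j. (a j)\<^sup>2) + (m / (\<eta> * s0))\<^sup>2) - 8 * m / \<eta> \<le> error_sum a b x"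
proof -
  define U where "U \<omega> = centred_quad a (\<lambda>j. \<xi> j \<omega>)" for \<omega>
  define U' where "U' \<omega> = centred_quad a (\<lambda>j. \<xi> j \<omega> + b j)" for \<omega>
  define L where "L \<omega> = (\<Sum>j. 2 * a j * b j * \<xi> j \<omega>)" for \<omega>
  define D where "D = (\<Sum>j. a j * (b j)\<^sup>2)"
  have [measurable]: "U \<in> borel_measurable M" "U' \<in> borel_measurable M" "L \<in> borel_measurable M"
    unfolding U_def[abs_def] U'_def[abs_def] L_def[abs_def] by measurable
  have D: "0 \<le> D" unfolding D_def using a(1) by (intro suminf_nonneg b) simp
  have m: "0 \<le> m" using a(1,2) order_trans by blast
  have "prob {\<omega> \<in> space M. \<not> x < U \<omega>} \<le>
      prob ({\<omega> \<in> space M. \<not> x < U' \<omega>} \<union> ({\<omega> \<in> space M. \<bar>U \<omega> - x\<bar> \<le> \<eta>} \<union> {\<omega> \<in> space M. \<eta> / 2 \<le> \<bar>L \<omega>\<bar>}))"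
  proof (rule finite_measure_mono_AE)
    show "AE \<omega> in M. \<omega> \<in> {\<omega> \<in> space M. \<not> x < U \<omega>} \<longrightarrow> \<omega> \<in> {\<omega> \<in> space M. \<not> x < U' \<omega>} \<union>
        ({\<omega> \<in> space M. \<bar>U \<omega> - x\<bar> \<le> \<eta>} \<union> {\<omega> \<in> space M. \<eta> / 2 \<le> \<bar>L \<omega>\<bar>})"
      using centred_quad_shift[OF a(1,3) b]
    proof eventually_elim
      case (elim \<omega>)
      then have "U' \<omega> = U \<omega> + D + L \<omega>" by (simp add: U_def U'_def L_def D_def)
      then show ?case using \<eta> by (auto simp: D_def[symmetric] abs_if)
    qed
  qed measurable
  also have "\<dots> \<le> prob {\<omega> \<in> space M. \<not> x < U' \<omega>} +
      (prob {\<omega> \<in> space M. \<bar>U \<omega> - x\<bar> \<le> \<eta>} + prob {\<omega> \<in> space M. \<eta> / 2 \<le> \<bar>L \<omega>\<bar>})"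
    by (intro order_trans[OF measure_Un_le] add_left_mono) measurable
  also have "prob {\<omega> \<in> space M. \<eta> / 2 \<le> \<bar>L \<omega>\<bar>} \<le> 4 * m * D / (\<eta> / 2)\<^sup>2"
    unfolding L_def D_def using \<eta>(1) by (intro linear_term_tail a b) simp
  also have "4 * m * D / (\<eta> / 2)\<^sup>2 \<le> 4 * m * (\<eta> / 2) / (\<eta> / 2)\<^sup>2"
    using \<eta>(2) m by (intro divide_right_mono mult_left_mono) (auto simp: D_def)
  also have "4 * m * (\<eta> / 2) / (\<eta> / 2)\<^sup>2 = 8 * m / \<eta>"
    using \<eta>(1) by (simp add: field_simps power2_eq_square)
  also have "prob {\<omega> \<in> space M. \<bar>U \<omega> - x\<bar> \<le> \<eta>}
      \<le> exp (1/2) * (\<eta> / sqrt (\<Sum>j. (a j)\<^sup>2) + (m / (\<eta> * s0))\<^sup>2)"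
    unfolding U_def by (rule centred_quad_concentration[OF decay a pos \<eta>(1)])
  also have "prob {\<omega> \<in> space M. \<not> x < U \<omega>} = 1 - prob {\<omega> \<in> space M. x < U \<omega>}"
    by (rule prob_neg) measurable
  finally show ?thesis unfolding error_sum_def U_def U'_def by linarith
qed

text \<open>
  Unless \<open>\<bar>L\<bar>\<close> is at least half the shift, \<open>U\<^sub>b \<le> x\<close> forces \<open>U\<^sub>0 \<le> x - \<delta>\<close>, so the mass of \<open>U\<^sub>0\<close> in
  \<open>(x - \<delta>, x]\<close> contributes to neither error. A larger shift \<open>D\<close> makes \<open>L\<close> relatively
  smaller, since \<open>Var L / D\<^sup>2 \<le> 4 m / D\<close>, so the bound for \<open>D = 2 \<delta>\<close> serves for all larger shifts.
\<close>

lemma error_sum_le: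
  assumes a: "\<And>j. 0 \<le> a j" "\<And>j. a j \<le> m" "summable a"
    and b: "summable (\<lambda>j. a j * (b j)\<^sup>2)"
    and \<delta>: "0 < \<delta>" "2 * \<delta> \<le> (\<Sum>j. a j * (b j)\<^sup>2)"
  shows "error_sum a b x
    \<le> 1 - prob {\<omega> \<in> space M. x - \<delta> < centred_quad a (\<lambda>j. \<xi> j \<omega>) \<and> centred_quad a (\<lambda>j. \<xi> j \<omega>) \<le> x} + 8 * m / \<delta>"
proof -
  define U where "U \<omega> = centred_quad a (\<lambda>j. \<xi> j \<omega>)" for \<omega>
  define U' where "U' \<omega> = centred_quad a (\<lambda>j. \<xi> j \<omega> + b j)" for \<omega>
  define L where "L \<omega> = (\<Sum>j. 2 * a j * b j * \<xi> j \<omega>)" for \<omega>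
  define D where "D = (\<Sum>j. a j * (b j)\<^sup>2)"
  have [measurable]: "U \<in> borel_measurable M" "U' \<in> borel_measurable M" "L \<in> borel_measurable M"
    unfolding U_def[abs_def] U'_def[abs_def] L_def[abs_def] by measurable
  have D: "0 < D" "2 * \<delta> \<le> D" using \<delta> by (auto simp: D_def)
  have m: "0 \<le> m" using a(1,2) order_trans by blast
  have "prob {\<omega> \<in> space M. \<not> x < U' \<omega>} \<le>
      prob ({\<omega> \<in> space M. U \<omega> \<le> x - \<delta>} \<union> {\<omega> \<in> space M. D / 2 \<le> \<bar>L \<omega>\<bar>})"
  proof (rule finite_measure_mono_AE)
    show "AE \<omega> in M. \<omega> \<in> {\<omega> \<in> space M. \<not> x < U' \<omega>} \<longrightarrow>
        \<omega> \<in> {\<omega> \<in> space M. U \<omega> \<le> x - \<delta>} \<union> {\<omega> \<in> space M. D / 2 \<le> \<bar>L \<omega>\<bar>}"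
      using centred_quad_shift[OF a(1,3) b]
    proof eventually_elim
      case (elim \<omega>)
      then have "U' \<omega> = U \<omega> + D + L \<omega>" by (simp add: U_def U'_def L_def D_def)
      then show ?case using D by (auto simp: abs_if)
    qed
  qed measurable
  also have "\<dots> \<le> prob {\<omega> \<in> space M. U \<omega> \<le> x - \<delta>} + prob {\<omega> \<in> space M. D / 2 \<le> \<bar>L \<omega>\<bar>}"
    by (rule measure_Un_le) measurable
  also have "prob {\<omega> \<in> space M. D / 2 \<le> \<bar>L \<omega>\<bar>} \<le> 4 * m * D / (D / 2)\<^sup>2"
    unfolding L_def D_def using D(1) by (intro linear_term_tail a b) (simp add: D_def)
  also have "4 * m * D / (D / 2)\<^sup>2 = 16 * m / D"
    using D(1) by (simp add: field_simps power2_eq_square)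
  also have "16 * m / D \<le> 16 * m / (2 * \<delta>)"
    using D \<delta>(1) m by (intro divide_left_mono) auto
  finally have 1: "prob {\<omega> \<in> space M. \<not> x < U' \<omega>} \<le> prob {\<omega> \<in> space M. U \<omega> \<le> x - \<delta>} + 8 * m / \<delta>"
    by simp
  have "prob {\<omega> \<in> space M. U \<omega> \<le> x - \<delta>} + prob {\<omega> \<in> space M. x - \<delta> < U \<omega> \<and> U \<omega> \<le> x}
      = prob ({\<omega> \<in> space M. U \<omega> \<le> x - \<delta>} \<union> {\<omega> \<in> space M. x - \<delta> < U \<omega> \<and> U \<omega> \<le> x})"
    by (rule finite_measure_Union[symmetric]) auto
  also have "{\<omega> \<in> space M. U \<omega> \<le> x - \<delta>} \<union> {\<omega> \<in> space M. x - \<delta> < U \<omega> \<and> U \<omega> \<le> x} = {\<omega> \<in> space M. \<not> x < U \<omega>}"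
    using \<delta>(1) by auto
  also have "prob \<dots> = 1 - prob {\<omega> \<in> space M. x < U \<omega>}"
    by (rule prob_neg) measurable
  finally show ?thesis using 1 unfolding error_sum_def U_def U'_def by linarith
qed

text \<open>
  In both directions the remainder terms vanish with \<open>m\<close>. A vanishing shift leaves a lower limit of
  the error sum of at least \<open>1 - O(\<eta>)\<close> for every fixed \<open>\<eta>\<close>. Conversely, the thresholds are placed at the right end of
  an interval of fixed length that carries mass at least \<open>p\<close>, where \<open>p\<close> does not depend on \<open>n\<close>;
  wherever the shift exceeds twice that length, the error sum is at most \<open>1 - p + o(1)\<close>.
\<close>

theorem no_power_iff_shift_vanishes:
  assumes a: "\<And>n j. 1 \<le> n \<Longrightarrow> 0 \<le> a n j" "\<And>n j. 1 \<le> n \<Longrightarrow> a n j \<le> m n"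
      "\<And>n. 1 \<le> n \<Longrightarrow> summable (a n)" "\<And>n. 1 \<le> n \<Longrightarrow> summable (\<lambda>j. (a n j)\<^sup>2)"
    and V: "0 < v" "\<And>n. 1 \<le> n \<Longrightarrow> v \<le> (\<Sum>j. (a n j)\<^sup>2)" "\<And>n. 1 \<le> n \<Longrightarrow> (\<Sum>j. (a n j)\<^sup>2) \<le> w"
    and m: "m \<longlonglongrightarrow> 0"
    and b: "\<And>n. 1 \<le> n \<Longrightarrow> summable (\<lambda>j. a n j * (b n j)\<^sup>2)"
  shows "(\<forall>x. 1 \<le> liminf (\<lambda>n. ereal (error_sum (a n) (b n) (x n)))) \<longleftrightarrow>
    (\<lambda>n. \<Sum>j. a n j * (b n j)\<^sup>2) \<longlonglongrightarrow> 0"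
proof
  assume *: "(\<lambda>n. \<Sum>j. a n j * (b n j)\<^sup>2) \<longlonglongrightarrow> 0"
  obtain s0 where decay: "0 < s0" "\<And>s. \<bar>s\<bar> \<le> s0 \<Longrightarrow> cmod (char centred_chisq s) \<le> exp (- s\<^sup>2 / 2)"
    using char_centred_chisq_decay by blast
  show "\<forall>x. 1 \<le> liminf (\<lambda>n. ereal (error_sum (a n) (b n) (x n)))"
    unfolding le_Liminf_iff
  proof (intro allI impI)
    fix x :: "nat \<Rightarrow> real" and y :: ereal assume "y < 1"
    then obtain y' where y': "y \<le> ereal y'" "y' < 1"
      by (metis ereal_dense2 ereal_less(3) less_ereal.simps(1) less_imp_le one_ereal_def)
    have y'_less: "y' < 1 - (1 - y') / 2"
      using y'(2) by (simp add: field_simps)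
    \<comment> \<open>makes the concentration term for interval length \<open>\<eta>\<close> equal to half of the gap \<open>1 - y'\<close>\<close>
    define \<eta> where "\<eta> = (1 - y') * sqrt v / (2 * exp (1/2))"
    have \<eta>: "0 < \<eta>" "exp (1/2) * (\<eta> / sqrt v) = (1 - y') / 2"
      using y'(2) V(1) by (auto simp: \<eta>_def)
    have limit_value: "1 - exp (1/2) * (\<eta> / sqrt v + (0 / (\<eta> * s0))\<^sup>2) - 8 * 0 / \<eta> = 1 - (1 - y') / 2"
      unfolding \<eta>(2)[symmetric] by simp
    have "(\<lambda>n. 1 - exp (1/2) * (\<eta> / sqrt v + (m n / (\<eta> * s0))\<^sup>2) - 8 * m n / \<eta>) \<longlonglongrightarrow> 1 - (1 - y') / 2"
      unfolding limit_value[symmetric] by (intro tendsto_intros m) (use \<eta> decay in auto)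
    then have "\<forall>\<^sub>F n in sequentially. y' < 1 - exp (1/2) * (\<eta> / sqrt v + (m n / (\<eta> * s0))\<^sup>2) - 8 * m n / \<eta>"
      by (rule order_tendstoD(1)) (rule y'_less)
    moreover have "\<forall>\<^sub>F n in sequentially. (\<Sum>j. a n j * (b n j)\<^sup>2) < \<eta> / 2"
      by (rule order_tendstoD(2)[OF *]) (use \<eta> in simp)
    moreover have "\<forall>\<^sub>F n in sequentially. (1::nat) \<le> n" by (rule eventually_ge_at_top)
    ultimately show "\<forall>\<^sub>F n in sequentially. y < ereal (error_sum (a n) (b n) (x n))"
    proof eventually_elim
      case (elim n)
      have "1 - exp (1/2) * (\<eta> / sqrt (\<Sum>j. (a n j)\<^sup>2) + (m n / (\<eta> * s0))\<^sup>2) - 8 * m n / \<eta>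
          \<le> error_sum (a n) (b n) (x n)"
        using elim V(1) V(2)[of n] by (intro error_sum_ge decay a b \<eta>) auto
      moreover have "exp (1/2) * (\<eta> / sqrt (\<Sum>j. (a n j)\<^sup>2) + (m n / (\<eta> * s0))\<^sup>2)
          \<le> exp (1/2) * (\<eta> / sqrt v + (m n / (\<eta> * s0))\<^sup>2)"
        using V(1) V(2)[of n] elim \<eta>(1) by (intro mult_left_mono add_right_mono frac_le) auto
      ultimately have "y' < error_sum (a n) (b n) (x n)" using elim(1) by linarith
      then show ?case using y'(1) by (meson le_less_trans ereal_less_eq(3) less_ereal.simps(1))
    qed
  qed
next
  assume *: "\<forall>x. 1 \<le> liminf (\<lambda>n. ereal (error_sum (a n) (b n) (x n)))"
  have nonneg: "0 \<le> (\<Sum>j. a n j * (b n j)\<^sup>2)" if "1 \<le> n" for n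
    using a(1) b that by (intro suminf_nonneg) auto
  show "(\<lambda>n. \<Sum>j. a n j * (b n j)\<^sup>2) \<longlonglongrightarrow> 0"
  proof (rule order_tendstoI)
    fix y :: real assume "y < 0"
    then show "\<forall>\<^sub>F n in sequentially. y < (\<Sum>j. a n j * (b n j)\<^sup>2)"
      by (intro eventually_mono[OF eventually_ge_at_top[of 1]] less_le_trans[OF _ nonneg])
  next
    fix y :: real assume y: "0 < y"
    define \<delta> where "\<delta> = y / 2"
    have \<delta>: "0 < \<delta>" using y by (simp add: \<delta>_def)
    have w: "0 < w" using V(1) V(2,3)[of 1] by simp
    \<comment> \<open>Chebyshev with variance at most \<open>2 w\<close> leaves mass at most \<open>1/2\<close> outside \<open>(- R, R)\<close>\<close>
    define R where "R = 2 * sqrt w"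
    have R: "0 < R" "R\<^sup>2 = 4 * w" using w by (simp_all add: R_def power_mult_distrib)
    define p where "p = 1 / (2 * (2 * R / \<delta> + 2))"
    have p: "0 < p" unfolding p_def using R \<delta> by (simp add: add_pos_pos)
    have mass: "\<exists>x. p \<le> prob {\<omega> \<in> space M. x - \<delta> < centred_quad (a n) (\<lambda>j. \<xi> j \<omega>) \<and> centred_quad (a n) (\<lambda>j. \<xi> j \<omega>) \<le> x}"
      if n: "1 \<le> n" for n
      unfolding p_def
    proof (rule interval_of_mass)
      have "prob {\<omega> \<in> space M. R \<le> \<bar>centred_quad (a n) (\<lambda>j. \<xi> j \<omega>)\<bar>} \<le> 2 * (\<Sum>j. (a n j)\<^sup>2) / R\<^sup>2"
        using a n R by (intro centred_quad_tail) auto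
      also have "\<dots> \<le> 1/2" using V(3)[OF n] w by (simp add: R(2))
      finally show "prob {\<omega> \<in> space M. R \<le> \<bar>centred_quad (a n) (\<lambda>j. \<xi> j \<omega>)\<bar>} \<le> 1/2" .
    qed (use R \<delta> in auto)
    have "\<exists>x. \<forall>n. 1 \<le> n \<longrightarrow>
        p \<le> prob {\<omega> \<in> space M. x n - \<delta> < centred_quad (a n) (\<lambda>j. \<xi> j \<omega>) \<and> centred_quad (a n) (\<lambda>j. \<xi> j \<omega>) \<le> x n}"
      by (rule choice) (use mass in blast)
    then obtain x where x: "\<And>n. 1 \<le> n \<Longrightarrow>
        p \<le> prob {\<omega> \<in> space M. x n - \<delta> < centred_quad (a n) (\<lambda>j. \<xi> j \<omega>) \<and> centred_quad (a n) (\<lambda>j. \<xi> j \<omega>) \<le> x n}"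
      by blast
    have "ereal (1 - p / 2) < 1" using p by simp
    with *[THEN spec[of _ x]] have ev: "\<forall>\<^sub>F n in sequentially. ereal (1 - p / 2) < ereal (error_sum (a n) (b n) (x n))"
      unfolding le_Liminf_iff by blast
    have "(\<lambda>n. 8 * m n / \<delta>) \<longlonglongrightarrow> 8 * 0 / \<delta>"
      by (intro tendsto_intros m) (use \<delta> in auto)
    then have "\<forall>\<^sub>F n in sequentially. 8 * m n / \<delta> < p / 2"
      by (rule order_tendstoD(2)) (use p in simp)
    with ev show "\<forall>\<^sub>F n in sequentially. (\<Sum>j. a n j * (b n j)\<^sup>2) < y"
      using eventually_ge_at_top[of 1]
    proof eventually_elim
      case (elim n)
      show ?case
      proof (rule ccontr)
        assume "\<not> ?thesis"
        then have "error_sum (a n) (b n) (x n) \<le> 1 - prob {\<omega> \<in> space M.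
            x n - \<delta> < centred_quad (a n) (\<lambda>j. \<xi> j \<omega>) \<and> centred_quad (a n) (\<lambda>j. \<xi> j \<omega>) \<le> x n} + 8 * m n / \<delta>"
          using elim a b \<delta> by (intro error_sum_le) (auto simp: \<delta>_def)
        with elim x[of n] show False by simp
      qed
    qed
  qed
qed

end


section \<open>Fourier coefficients\<close>

lemma L2_mult_integrable:
  assumes "g \<in> L2" "h \<in> L2"
  shows "integrable leb01 (\<lambda>t. g t * h t)"
proof (rule Bochner_Integration.integrable_bound)
  have [measurable]: "g \<in> borel_measurable leb01" "h \<in> borel_measurable leb01"
    using assms by (auto simp: L2_def)
  show "integrable leb01 (\<lambda>t. (g t)\<^sup>2 + (h t)\<^sup>2)"
    using assms by (auto simp: L2_def)
  show "(\<lambda>t. g t * h t) \<in> borel_measurable leb01" by measurable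
  show "AE t in leb01. norm (g t * h t) \<le> norm ((g t)\<^sup>2 + (h t)\<^sup>2)"
  proof (rule AE_I2)
    fix t
    have "2 * \<bar>g t * h t\<bar> \<le> (g t)\<^sup>2 + (h t)\<^sup>2"
      using sum_squares_bound[of "\<bar>g t\<bar>" "\<bar>h t\<bar>"] by (simp add: abs_mult mult.assoc)
    moreover have "0 \<le> \<bar>g t * h t\<bar>" by simp
    ultimately show "norm (g t * h t) \<le> norm ((g t)\<^sup>2 + (h t)\<^sup>2)" by simp
  qed
qed

lemma bessel_L2:
  assumes e: "L2_orthonormal e" and g: "g \<in> L2"
  shows "summable (\<lambda>j. (L2_inner g (e (Suc j)))\<^sup>2) \<and> (\<Sum>j. (L2_inner g (e (Suc j)))\<^sup>2) \<le> (L2_norm g)\<^sup>2"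
proof -
  define c where "c j = L2_inner g (e (Suc j))" for j
  have eL: "e (Suc j) \<in> L2" for j using e by (simp add: L2_orthonormal_def)
  have ee: "(LINT t|leb01. e (Suc i) t * e (Suc j) t) = (if i = j then 1 else 0)" for i j
    using e by (simp add: L2_orthonormal_def L2_inner_def)
  have ge: "(LINT t|leb01. g t * e (Suc j) t) = c j" for j
    by (simp add: c_def L2_inner_def)
  have gg: "integrable leb01 (\<lambda>t. (g t)\<^sup>2)" using g by (simp add: L2_def)
  note int = L2_mult_integrable[OF g eL] L2_mult_integrable[OF eL eL] gg
  have norm: "(L2_norm g)\<^sup>2 = (LINT t|leb01. (g t)\<^sup>2)"
    by (simp add: L2_norm_def)
  have fin: "(\<Sum>j<N. (c j)\<^sup>2) \<le> (L2_norm g)\<^sup>2" for N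
  proof -
    have "0 \<le> (LINT t|leb01. (g t - (\<Sum>j<N. c j * e (Suc j) t))\<^sup>2)"
      by (rule Bochner_Integration.integral_nonneg) simp
    also have "(\<lambda>t. (g t - (\<Sum>j<N. c j * e (Suc j) t))\<^sup>2) =
        (\<lambda>t. (g t)\<^sup>2 - 2 * (\<Sum>j<N. c j * (g t * e (Suc j) t)) +
          (\<Sum>i<N. \<Sum>j<N. c i * c j * (e (Suc i) t * e (Suc j) t)))"
    proof
      fix t
      let ?S = "\<Sum>j<N. c j * e (Suc j) t"
      have "(g t - ?S)\<^sup>2 = (g t)\<^sup>2 - 2 * (g t * ?S) + ?S * ?S"
        by (simp add: power2_eq_square algebra_simps)
      also have "g t * ?S = (\<Sum>j<N. c j * (g t * e (Suc j) t))"
        by (simp add: sum_distrib_left mult_ac)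
      also have "?S * ?S = (\<Sum>i<N. \<Sum>j<N. c i * c j * (e (Suc i) t * e (Suc j) t))"
        by (simp add: sum_product mult_ac)
      finally show "(g t - ?S)\<^sup>2 = (g t)\<^sup>2 - 2 * (\<Sum>j<N. c j * (g t * e (Suc j) t)) +
          (\<Sum>i<N. \<Sum>j<N. c i * c j * (e (Suc i) t * e (Suc j) t))" .
    qed
    also have "(LINT t|leb01. (g t)\<^sup>2 - 2 * (\<Sum>j<N. c j * (g t * e (Suc j) t)) +
          (\<Sum>i<N. \<Sum>j<N. c i * c j * (e (Suc i) t * e (Suc j) t)))
        = (LINT t|leb01. (g t)\<^sup>2) - 2 * (\<Sum>j<N. c j * c j) +
          (\<Sum>i<N. \<Sum>j<N. c i * c j * (if i = j then 1 else 0))"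
      using int by (simp add: ee ge)
    also have "\<dots> = (L2_norm g)\<^sup>2 - (\<Sum>j<N. (c j)\<^sup>2)"
      by (simp add: norm power2_eq_square[of "c _"] if_distrib[of "\<lambda>x. _ * x"] cong: if_cong)
    finally show ?thesis by simp
  qed
  have "summable (\<lambda>j. (c j)\<^sup>2)"
    by (rule summableI_nonneg_bounded[where x="(L2_norm g)\<^sup>2"]) (use fin in auto)
  moreover from this have "(\<Sum>j. (c j)\<^sup>2) \<le> (L2_norm g)\<^sup>2"
    by (rule suminf_le_const) (use fin in auto)
  ultimately show ?thesis by (simp add: c_def)
qed

section \<open>The order of the coefficients\<close>

text \<open>
  The set whose supremum is \<open>k_idx\<close> is bounded, since the partial sums tend to \<open>rho > rho / 2\<close>. So
  the supremum is not the junk value of an unbounded set, and its successor violates the defining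
  inequality.
\<close>

lemma half_mass_up_to_k_idx:
  assumes summ: "summable (\<lambda>j. (\<kappa> n (Suc j))\<^sup>2)" and pos: "0 < rho \<kappa> n"
  shows "rho \<kappa> n / 2 < (\<Sum>j\<in>{1..k_idx \<kappa> n}. (\<kappa> n j)\<^sup>2)"
proof -
  define S where "S = {k. (\<Sum>j\<in>{1..<k}. (\<kappa> n j)\<^sup>2) \<le> rho \<kappa> n / 2}"
  have "(\<lambda>N. \<Sum>j<N. (\<kappa> n (Suc j))\<^sup>2) \<longlonglongrightarrow> rho \<kappa> n"
    unfolding rho_def by (rule summable_LIMSEQ[OF summ])
  then have "\<forall>\<^sub>F N in sequentially. rho \<kappa> n / 2 < (\<Sum>j<N. (\<kappa> n (Suc j))\<^sup>2)"
    by (rule order_tendstoD(1)) (use pos in simp)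
  then obtain N where N: "rho \<kappa> n / 2 < (\<Sum>j<N. (\<kappa> n (Suc j))\<^sup>2)"
    by (auto simp: eventually_sequentially)
  also have "(\<Sum>j<N. (\<kappa> n (Suc j))\<^sup>2) = (\<Sum>j\<in>{1..<Suc N}. (\<kappa> n j)\<^sup>2)"
    by (simp add: sum.atLeast1_atMost_eq atLeastLessThanSuc_atLeastAtMost)
  finally have N': "rho \<kappa> n / 2 < (\<Sum>j\<in>{1..<Suc N}. (\<kappa> n j)\<^sup>2)" .
  have "k < Suc N" if "k \<in> S" for k
  proof (rule ccontr)
    assume "\<not> k < Suc N"
    then have "(\<Sum>j\<in>{1..<Suc N}. (\<kappa> n j)\<^sup>2) \<le> (\<Sum>j\<in>{1..<k}. (\<kappa> n j)\<^sup>2)"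
      by (intro sum_mono2) auto
    with N' that show False by (simp add: S_def)
  qed
  then have "bdd_above S" by (meson bdd_above.I less_imp_le)
  then have "Suc (k_idx \<kappa> n) \<notin> S"
    using cSup_upper[of "Suc (k_idx \<kappa> n)" S] unfolding k_idx_def S_def[symmetric] by auto
  then show ?thesis
    by (simp add: S_def atLeastLessThanSuc_atLeastAtMost)
qed

text \<open>
  Compare \<open>\<Sum> \<kappa>\<^sub>j\<^sup>4\<close> with \<open>rho\<close> by extracting one factor \<open>\<kappa>\<^sub>j\<^sup>2\<close>: by monotonicity it is at least
  \<open>kappa_sq\<close> for \<open>j \<le> k\<close>, where half of \<open>rho\<close> is found, and at most \<open>\<kappa>\<^sub>1\<^sup>2\<close> everywhere.
\<close>

lemma kappa_sq_rho_le:
  assumes A1: "cond_A1 \<kappa>" and n: "1 \<le> n"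
    and summ: "summable (\<lambda>j. (\<kappa> n (Suc j))\<^sup>2)" "summable (\<lambda>j. (\<kappa> n (Suc j)) ^ 4)"
    and pos: "0 < rho \<kappa> n"
  shows "kappa_sq \<kappa> n * rho \<kappa> n \<le> 2 * (\<Sum>j. (\<kappa> n (Suc j)) ^ 4)"
    and "(\<Sum>j. (\<kappa> n (Suc j)) ^ 4) \<le> (\<kappa> n 1)\<^sup>2 * rho \<kappa> n"
proof -
  have mono: "(\<kappa> n j)\<^sup>2 \<le> (\<kappa> n i)\<^sup>2" if "1 \<le> i" "i \<le> j" for i j
    using A1 n that unfolding cond_A1_def by blast
  have "kappa_sq \<kappa> n * (rho \<kappa> n / 2) \<le> kappa_sq \<kappa> n * (\<Sum>j\<in>{1..k_idx \<kappa> n}. (\<kappa> n j)\<^sup>2)"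
    using half_mass_up_to_k_idx[OF summ(1) pos] by (intro mult_left_mono) (auto simp: kappa_sq_def)
  also have "\<dots> \<le> (\<Sum>j\<in>{1..k_idx \<kappa> n}. (\<kappa> n j) ^ 4)"
    unfolding sum_distrib_left
  proof (rule sum_mono)
    fix j assume "j \<in> {1..k_idx \<kappa> n}"
    then have "kappa_sq \<kappa> n * (\<kappa> n j)\<^sup>2 \<le> (\<kappa> n j)\<^sup>2 * (\<kappa> n j)\<^sup>2"
      unfolding kappa_sq_def by (intro mult_right_mono mono) auto
    then show "kappa_sq \<kappa> n * (\<kappa> n j)\<^sup>2 \<le> (\<kappa> n j) ^ 4"
      by (simp flip: power_add)
  qed
  also have "\<dots> = (\<Sum>j<k_idx \<kappa> n. (\<kappa> n (Suc j)) ^ 4)"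
    by (simp add: sum.atLeast1_atMost_eq)
  also have "\<dots> \<le> (\<Sum>j. (\<kappa> n (Suc j)) ^ 4)"
    by (rule sum_le_suminf[OF summ(2)]) auto
  finally show "kappa_sq \<kappa> n * rho \<kappa> n \<le> 2 * (\<Sum>j. (\<kappa> n (Suc j)) ^ 4)" by simp
  have "(\<Sum>j. (\<kappa> n (Suc j)) ^ 4) \<le> (\<Sum>j. (\<kappa> n 1)\<^sup>2 * (\<kappa> n (Suc j))\<^sup>2)"
  proof (rule suminf_le[OF _ summ(2) summable_mult[OF summ(1)]])
    fix j
    have "(\<kappa> n (Suc j))\<^sup>2 * (\<kappa> n (Suc j))\<^sup>2 \<le> (\<kappa> n 1)\<^sup>2 * (\<kappa> n (Suc j))\<^sup>2"
      by (intro mult_right_mono mono) auto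
    then show "(\<kappa> n (Suc j)) ^ 4 \<le> (\<kappa> n 1)\<^sup>2 * (\<kappa> n (Suc j))\<^sup>2"
      by (simp flip: power_add)
  qed
  also have "\<dots> = (\<kappa> n 1)\<^sup>2 * rho \<kappa> n"
    unfolding rho_def by (rule suminf_mult[OF summ(1)])
  finally show "(\<Sum>j. (\<kappa> n (Suc j)) ^ 4) \<le> (\<kappa> n 1)\<^sup>2 * rho \<kappa> n" .
qed

text \<open>
  \<open>\<Sum> \<kappa>\<^sub>j\<^sup>4\<close> has the order \<open>n powr (- 2)\<close> and \<open>rho\<close> has the order \<open>n powr (- 2 * r)\<close>, so their quotient
  bounds \<open>kappa_sq\<close> from above and \<open>\<kappa>\<^sub>1\<^sup>2\<close> from below. As A5 makes the two comparable, both have the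
  order of that quotient.
\<close>

lemma coefficient_order:
  assumes \<sigma>: "0 < \<sigma>" and A1: "cond_A1 \<kappa>" and A2: "cond_A2 \<sigma> \<kappa>" and A3: "cond_A3 r \<kappa>"
  shows "\<exists>K>0. \<forall>n\<ge>1. (real n)\<^sup>2 * real n powr (- 2 * r) * kappa_sq \<kappa> n \<le> K"
    and "\<exists>K>0. \<forall>n\<ge>1. K \<le> (real n)\<^sup>2 * real n powr (- 2 * r) * (\<kappa> n 1)\<^sup>2"
proof -
  obtain C1 C2 where C: "0 < C1" "0 < C2" and A: "\<And>n. 1 \<le> n \<Longrightarrow> summable (\<lambda>j. (\<kappa> n (Suc j)) ^ 4) \<and>
      C1 < A_coef \<sigma> \<kappa> n \<and> A_coef \<sigma> \<kappa> n < C2"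
    using A2 unfolding cond_A2_def by blast
  obtain c1 c2 where c: "0 < c1" "0 < c2" and R: "\<And>n. 1 \<le> n \<Longrightarrow> summable (\<lambda>j. (\<kappa> n (Suc j))\<^sup>2) \<and>
      c1 * real n powr (- 2 * r) \<le> rho \<kappa> n \<and> rho \<kappa> n \<le> c2 * real n powr (- 2 * r)"
    using A3 unfolding cond_A3_def by blast
  define q where "q n = (\<Sum>j. (\<kappa> n (Suc j)) ^ 4)" for n
  define p where "p n = real n powr (- 2 * r)" for n
  have p: "0 < p n" if "1 \<le> n" for n using that by (simp add: p_def)
  have q: "C1 * \<sigma> ^ 4 \<le> (real n)\<^sup>2 * q n" "(real n)\<^sup>2 * q n \<le> C2 * \<sigma> ^ 4" if "1 \<le> n" for n
    using A[OF that] \<sigma> by (auto simp: A_coef_def q_def field_simps)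
  have rho: "0 < rho \<kappa> n" if "1 \<le> n" for n
    using R[OF that] c(1) p[OF that] unfolding p_def by (meson less_le_trans mult_pos_pos)
  have "(real n)\<^sup>2 * p n * kappa_sq \<kappa> n \<le> 2 * C2 * \<sigma> ^ 4 / c1" if n: "1 \<le> n" for n
  proof -
    have "c1 * ((real n)\<^sup>2 * p n * kappa_sq \<kappa> n) = (real n)\<^sup>2 * (kappa_sq \<kappa> n * (c1 * p n))" by simp
    also have "\<dots> \<le> (real n)\<^sup>2 * (kappa_sq \<kappa> n * rho \<kappa> n)"
      using R[OF n] by (intro mult_left_mono) (auto simp: p_def kappa_sq_def)
    also have "\<dots> \<le> (real n)\<^sup>2 * (2 * q n)"
      using kappa_sq_rho_le(1)[OF A1 n _ _ rho[OF n]] R[OF n] A[OF n] unfolding q_def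
      by (intro mult_left_mono) auto
    finally show ?thesis using q(2)[OF n] c(1) by (simp add: field_simps)
  qed
  moreover have "0 < 2 * C2 * \<sigma> ^ 4 / c1" using C c \<sigma> by simp
  ultimately show "\<exists>K>0. \<forall>n\<ge>1. (real n)\<^sup>2 * real n powr (- 2 * r) * kappa_sq \<kappa> n \<le> K"
    unfolding p_def by blast
  have "C1 * \<sigma> ^ 4 / c2 \<le> (real n)\<^sup>2 * p n * (\<kappa> n 1)\<^sup>2" if n: "1 \<le> n" for n
  proof -
    have "(real n)\<^sup>2 * q n \<le> (real n)\<^sup>2 * ((\<kappa> n 1)\<^sup>2 * rho \<kappa> n)"
      using kappa_sq_rho_le(2)[OF A1 n _ _ rho[OF n]] R[OF n] A[OF n] unfolding q_def
      by (intro mult_left_mono) auto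
    also have "\<dots> \<le> (real n)\<^sup>2 * ((\<kappa> n 1)\<^sup>2 * (c2 * p n))"
      using R[OF n] by (intro mult_left_mono) (auto simp: p_def)
    finally show ?thesis using q(1)[OF n] c(2) by (simp add: field_simps)
  qed
  moreover have "0 < C1 * \<sigma> ^ 4 / c2" using C c \<sigma> by simp
  ultimately show "\<exists>K>0. \<forall>n\<ge>1. K \<le> (real n)\<^sup>2 * real n powr (- 2 * r) * (\<kappa> n 1)\<^sup>2"
    unfolding p_def by blast
qed


section \<open>The shift and the low-frequency energy\<close>

lemma low_frequency_indices:
  "{j. 1 \<le> j \<and> real j < x} = Suc ` {j. real (Suc j) < x}"
  "finite {j. real (Suc j) < x}"
proof -
  show "{j. 1 \<le> j \<and> real j < x} = Suc ` {j. real (Suc j) < x}"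
    by (auto simp: image_iff elim: not0_implies_Suc) (metis Suc_le_D of_nat_Suc add.commute)
  have "j \<le> nat \<lceil>x\<rceil>" if "real (Suc j) < x" for j
    using that by linarith
  then have "{j. real (Suc j) < x} \<subseteq> {..nat \<lceil>x\<rceil>}" by auto
  then show "finite {j. real (Suc j) < x}" by (rule finite_subset) simp
qed

text \<open>A4 controls \<open>\<kappa>\<^sup>2\<close> at the single index \<open>\<lfloor>c\<^sub>2 k\<rfloor>\<close>; monotonicity passes the bound on to all
  later indices. The floor must be at least 1 for this, whence the assumption on \<open>k_idx\<close>.\<close>

lemma tail_coefficients_small:
  assumes A1: "cond_A1 \<kappa>" and A4: "cond_A4 \<kappa>" and k: "\<And>n. 1 \<le> n \<Longrightarrow> 1 \<le> k_idx \<kappa> n" and \<tau>: "0 < \<tau>"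
  shows "\<exists>c2>0. \<forall>n\<ge>1. \<forall>j\<ge>1. c2 * real (k_idx \<kappa> n) \<le> real j \<longrightarrow> (\<kappa> n j)\<^sup>2 \<le> \<tau> * kappa_sq \<kappa> n"
proof -
  obtain C l where l: "1 < l" and A4': "\<And>n \<delta>. 1 \<le> n \<Longrightarrow> 0 < \<delta> \<Longrightarrow>
      (\<kappa> n (nat \<lfloor>(1 + \<delta>) * real (k_idx \<kappa> n)\<rfloor>))\<^sup>2 < C * (1 + \<delta>) powr (- l) * kappa_sq \<kappa> n"
    using A4 unfolding cond_A4_def by blast
  have "((\<lambda>x. C * x powr (- l)) \<longlongrightarrow> C * 0) at_top"
    using l by (intro tendsto_intros tendsto_neg_powr filterlim_ident) auto
  then have "\<forall>\<^sub>F x in at_top. C * x powr (- l) < \<tau>"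
    by (rule order_tendstoD(2)) (use \<tau> in simp)
  then obtain x0 where x0: "\<And>x. x0 \<le> x \<Longrightarrow> C * x powr (- l) < \<tau>"
    by (auto simp: eventually_at_top_linorder)
  define c2 where "c2 = max x0 2"
  have c2: "2 \<le> c2" "C * c2 powr (- l) < \<tau>" using x0[of c2] by (auto simp: c2_def)
  have "(\<kappa> n j)\<^sup>2 \<le> \<tau> * kappa_sq \<kappa> n"
    if n: "1 \<le> n" and j: "c2 * real (k_idx \<kappa> n) \<le> real j" for n j
  proof -
    define i where "i = nat \<lfloor>c2 * real (k_idx \<kappa> n)\<rfloor>"
    have "1 * 1 \<le> c2 * real (k_idx \<kappa> n)"
      using c2(1) k[OF n] by (intro mult_mono) auto
    then have "1 \<le> i" "i \<le> j"
      using j unfolding i_def by linarith+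
    then have "(\<kappa> n j)\<^sup>2 \<le> (\<kappa> n i)\<^sup>2"
      using A1 n unfolding cond_A1_def by blast
    also have "\<dots> \<le> C * c2 powr (- l) * kappa_sq \<kappa> n"
      using A4'[OF n, of "c2 - 1"] c2(1) by (simp add: i_def)
    also have "\<dots> \<le> \<tau> * kappa_sq \<kappa> n"
      using c2(2) by (intro mult_right_mono) (auto simp: kappa_sq_def)
    finally show ?thesis .
  qed
  then show ?thesis using c2(1) by (intro exI[of _ c2]) auto
qed

lemma low_coefficients_large:
  assumes A1: "cond_A1 \<kappa>" and A5: "cond_A5 \<kappa>"
  shows "\<exists>C>0. \<forall>n\<ge>1. \<forall>j\<ge>1. real j < c2 * real (k_idx \<kappa> n) \<longrightarrow> C * kappa_sq \<kappa> n \<le> (\<kappa> n j)\<^sup>2"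
proof -
  define c where "c = max c2 2"
  have "1 < c" by (simp add: c_def)
  then obtain C where C: "0 < C" and A5': "\<And>n. 1 \<le> n \<Longrightarrow>
      C * kappa_sq \<kappa> n \<le> (\<kappa> n (nat \<lfloor>c * real (k_idx \<kappa> n)\<rfloor>))\<^sup>2"
    using A5 unfolding cond_A5_def by blast
  have "C * kappa_sq \<kappa> n \<le> (\<kappa> n j)\<^sup>2"
    if n: "1 \<le> n" and j: "1 \<le> j" "real j < c2 * real (k_idx \<kappa> n)" for n j
  proof -
    have "c2 * real (k_idx \<kappa> n) \<le> c * real (k_idx \<kappa> n)"
      by (intro mult_right_mono) (auto simp: c_def)
    then have "j \<le> nat \<lfloor>c * real (k_idx \<kappa> n)\<rfloor>" using j by linarith
    then have "(\<kappa> n (nat \<lfloor>c * real (k_idx \<kappa> n)\<rfloor>))\<^sup>2 \<le> (\<kappa> n j)\<^sup>2"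
      using A1 n j unfolding cond_A1_def by blast
    with A5'[OF n] show ?thesis by (rule order_trans)
  qed
  with C show ?thesis by blast
qed

text \<open>
  Here \<open>p\<close> is the order of the signal energy, and \<open>n\<^sup>2 p kappa_sq\<close> has constant order. If the
  weighted energy vanishes, so does its part on \<open>j < c\<^sub>2 k\<close>, where the weights are at least a
  multiple of \<open>kappa_sq\<close>. Conversely, split the weighted energy at \<open>c\<^sub>2 k\<close>: the low part is at most a
  multiple of \<open>kappa_sq\<close> times an energy of order \<open>o(p)\<close>, and the tail is at most
  \<open>\<tau> kappa_sq B p\<close>, where \<open>\<tau>\<close> is small by the choice of \<open>c\<^sub>2\<close>.
\<close>

lemma weighted_energy_vanishes_iff:
  fixes p :: "nat \<Rightarrow> real"
  assumes A1: "cond_A1 \<kappa>" and A4: "cond_A4 \<kappa>" and A5: "cond_A5 \<kappa>"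
    and k: "\<And>n. 1 \<le> n \<Longrightarrow> 1 \<le> k_idx \<kappa> n"
    and p: "\<And>n. 1 \<le> n \<Longrightarrow> 0 < p n"
    and upper: "0 < K" "\<And>n. 1 \<le> n \<Longrightarrow> (real n)\<^sup>2 * p n * kappa_sq \<kappa> n \<le> K"
    and lower: "0 < K'" "\<And>n. 1 \<le> n \<Longrightarrow> K' \<le> (real n)\<^sup>2 * p n * (\<kappa> n 1)\<^sup>2"
    and \<theta>: "\<And>n. 1 \<le> n \<Longrightarrow> summable (\<lambda>j. (\<theta> n (Suc j))\<^sup>2)"
      "0 \<le> B" "\<And>n. 1 \<le> n \<Longrightarrow> (\<Sum>j. (\<theta> n (Suc j))\<^sup>2) \<le> B * p n"
    and \<kappa>\<theta>: "\<And>n. 1 \<le> n \<Longrightarrow> summable (\<lambda>j. (\<kappa> n (Suc j))\<^sup>2 * (\<theta> n (Suc j))\<^sup>2)"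
  shows "(\<lambda>n. (real n)\<^sup>2 * (\<Sum>j. (\<kappa> n (Suc j))\<^sup>2 * (\<theta> n (Suc j))\<^sup>2)) \<longlonglongrightarrow> 0 \<longleftrightarrow>
    (\<forall>c2>0. (\<lambda>n. \<Sum>j | 1 \<le> j \<and> real j < c2 * real (k_idx \<kappa> n). (\<theta> n j)\<^sup>2) \<in> o(p))"
proof -
  define E where "E n = (\<Sum>j. (\<kappa> n (Suc j))\<^sup>2 * (\<theta> n (Suc j))\<^sup>2)" for n
  define low where "low c2 n = (\<Sum>j | real (Suc j) < c2 * real (k_idx \<kappa> n). (\<theta> n (Suc j))\<^sup>2)" for c2 n
  have low_eq: "(\<Sum>j | 1 \<le> j \<and> real j < c2 * real (k_idx \<kappa> n). (\<theta> n j)\<^sup>2) = low c2 n" for c2 n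
    unfolding low_def low_frequency_indices(1) by (subst sum.reindex) auto
  have low0: "0 \<le> low c2 n" for c2 n unfolding low_def by (rule sum_nonneg) simp
  have E0: "0 \<le> E n" if "1 \<le> n" for n
    unfolding E_def using \<kappa>\<theta>[OF that] by (intro suminf_nonneg) auto
  obtain q Q where q: "0 < q" "0 < Q"
    and cmp: "\<forall>\<^sub>F n in sequentially. q \<le> (\<kappa> n 1)\<^sup>2 / kappa_sq \<kappa> n \<and> (\<kappa> n 1)\<^sup>2 / kappa_sq \<kappa> n \<le> Q"
    using A5 unfolding cond_A5_def asymp_comparable_def by blast
  have first: "\<forall>\<^sub>F n in sequentially. (\<kappa> n 1)\<^sup>2 \<le> Q * kappa_sq \<kappa> n"
    using cmp
  proof eventually_elim
    case (elim n)
    then have "kappa_sq \<kappa> n \<noteq> 0" using q(1) by auto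
    then have "0 < kappa_sq \<kappa> n" by (simp add: kappa_sq_def)
    then show ?case using elim by (simp add: field_simps)
  qed
  have ge1: "\<forall>\<^sub>F n in sequentially. (1::nat) \<le> n" by (rule eventually_ge_at_top)
  have "(\<lambda>n. (real n)\<^sup>2 * E n) \<longlonglongrightarrow> 0 \<longleftrightarrow> (\<forall>c2>0. low c2 \<in> o(p))"
  proof
    assume lim: "(\<lambda>n. (real n)\<^sup>2 * E n) \<longlonglongrightarrow> 0"
    show "\<forall>c2>0. low c2 \<in> o(p)"
    proof (intro allI impI landau_o.smallI)
      fix c2 e :: real assume "0 < c2" and e: "0 < e"
      obtain C where C: "0 < C" and Cle: "\<And>n j. 1 \<le> n \<Longrightarrow> 1 \<le> j \<Longrightarrow>
          real j < c2 * real (k_idx \<kappa> n) \<Longrightarrow> C * kappa_sq \<kappa> n \<le> (\<kappa> n j)\<^sup>2"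
        using low_coefficients_large[OF A1 A5] by meson
      have "\<forall>\<^sub>F n in sequentially. (real n)\<^sup>2 * E n < e * C * (K' / Q)"
        by (rule order_tendstoD(2)[OF lim]) (use e C lower(1) q(2) in simp)
      with first ge1 show "\<forall>\<^sub>F n in sequentially. norm (low c2 n) \<le> e * norm (p n)"
      proof eventually_elim
        case (elim n)
        have n: "1 \<le> n" using elim by simp
        let ?J = "{j. real (Suc j) < c2 * real (k_idx \<kappa> n)}"
        have "C * kappa_sq \<kappa> n * low c2 n \<le> (\<Sum>j\<in>?J. (\<kappa> n (Suc j))\<^sup>2 * (\<theta> n (Suc j))\<^sup>2)"
          unfolding low_def sum_distrib_left
          by (intro sum_mono mult_right_mono Cle n) auto
        also have "\<dots> \<le> E n"
          unfolding E_def by (intro sum_le_suminf \<kappa>\<theta> n low_frequency_indices) auto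
        finally have 1: "C * kappa_sq \<kappa> n * low c2 n \<le> E n" .
        have "K' \<le> (real n)\<^sup>2 * p n * (Q * kappa_sq \<kappa> n)"
          using lower(2)[OF n] elim(1) p[OF n] by (elim order_trans) (intro mult_left_mono, auto)
        then have 2: "K' / Q \<le> (real n)\<^sup>2 * p n * kappa_sq \<kappa> n"
          using q(2) by (simp add: field_simps)
        have "C * (K' / Q) * low c2 n \<le> C * ((real n)\<^sup>2 * p n * kappa_sq \<kappa> n) * low c2 n"
          using 2 C low0 by (intro mult_right_mono mult_left_mono) auto
        also have "\<dots> = (real n)\<^sup>2 * p n * (C * kappa_sq \<kappa> n * low c2 n)" by simp
        also have "\<dots> \<le> (real n)\<^sup>2 * p n * E n"
          using 1 p[OF n] by (intro mult_left_mono) auto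
        also have "\<dots> = p n * ((real n)\<^sup>2 * E n)" by simp
        also have "\<dots> \<le> p n * (e * C * (K' / Q))"
          using elim p[OF n] by (intro mult_left_mono) auto
        finally have "C * (K' / Q) * low c2 n \<le> C * (K' / Q) * (e * p n)" by (simp add: mult_ac)
        moreover have "0 < C * (K' / Q)" using C lower(1) q(2) by simp
        ultimately have "low c2 n \<le> e * p n" by (rule mult_left_le_imp_le)
        then show ?case using low0 p[OF n] by simp
      qed
    qed
  next
    assume small: "\<forall>c2>0. low c2 \<in> o(p)"
    show "(\<lambda>n. (real n)\<^sup>2 * E n) \<longlonglongrightarrow> 0"
    proof (rule order_tendstoI)
      fix y :: real assume "y < 0"
      then show "\<forall>\<^sub>F n in sequentially. y < (real n)\<^sup>2 * E n"
        by (intro eventually_mono[OF ge1] less_le_trans[OF _ mult_nonneg_nonneg[OF _ E0]]) auto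
    next
      fix y :: real assume y: "0 < y"
      \<comment> \<open>each of the two parts of the split sum is to stay below \<open>y / 4\<close>\<close>
      define \<tau> where "\<tau> = y / (4 * K * (B + 1))"
      define \<gamma> where "\<gamma> = y / (4 * K * Q)"
      have \<tau>\<gamma>: "0 < \<tau>" "0 < \<gamma>" using y upper(1) q(2) \<theta>(2) by (auto simp: \<tau>_def \<gamma>_def)
      have total: "K * (Q * \<gamma> + \<tau> * B) < y"
      proof -
        have "K * (Q * \<gamma>) = y / 4" using upper(1) q(2) by (simp add: \<gamma>_def)
        moreover have "K * (\<tau> * B) \<le> K * (\<tau> * (B + 1))"
          using upper(1) \<tau>\<gamma> by (intro mult_left_mono) auto
        moreover have "K * (\<tau> * (B + 1)) = y / 4"
          using upper(1) \<theta>(2) by (simp add: \<tau>_def)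
        ultimately show ?thesis using y by (simp add: distrib_left)
      qed
      obtain c2 where c2: "0 < c2" and tail: "\<And>n j. 1 \<le> n \<Longrightarrow> 1 \<le> j \<Longrightarrow>
          c2 * real (k_idx \<kappa> n) \<le> real j \<Longrightarrow> (\<kappa> n j)\<^sup>2 \<le> \<tau> * kappa_sq \<kappa> n"
        using tail_coefficients_small[OF A1 A4 k \<tau>\<gamma>(1)] by meson
      have "\<forall>\<^sub>F n in sequentially. norm (low c2 n) \<le> \<gamma> * norm (p n)"
        using small c2 \<tau>\<gamma>(2) by (intro landau_o.smallD) auto
      with first ge1 show "\<forall>\<^sub>F n in sequentially. (real n)\<^sup>2 * E n < y"
      proof eventually_elim
        case (elim n)
        have n: "1 \<le> n" using elim by simp
        let ?J = "{j. real (Suc j) < c2 * real (k_idx \<kappa> n)}"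
        let ?k = "kappa_sq \<kappa> n"
        have k0: "0 \<le> ?k" by (simp add: kappa_sq_def)
        have sumsJ: "(\<lambda>j. if j \<in> ?J then (\<theta> n (Suc j))\<^sup>2 else 0) sums low c2 n"
          unfolding low_def by (rule sums_If_finite_set[OF low_frequency_indices(2)])
        have "E n \<le> (\<Sum>j. Q * ?k * (if j \<in> ?J then (\<theta> n (Suc j))\<^sup>2 else 0) + \<tau> * ?k * (\<theta> n (Suc j))\<^sup>2)"
          unfolding E_def
        proof (rule suminf_le[OF _ \<kappa>\<theta>[OF n]])
          show "summable (\<lambda>j. Q * ?k * (if j \<in> ?J then (\<theta> n (Suc j))\<^sup>2 else 0) + \<tau> * ?k * (\<theta> n (Suc j))\<^sup>2)"
            by (intro summable_add summable_mult sums_summable[OF sumsJ] \<theta>(1) n)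
          fix j
          have nonneg: "0 \<le> \<tau> * ?k * (\<theta> n (Suc j))\<^sup>2" "0 \<le> Q * ?k * (\<theta> n (Suc j))\<^sup>2"
            using \<tau>\<gamma> k0 q(2) by simp_all
          show "(\<kappa> n (Suc j))\<^sup>2 * (\<theta> n (Suc j))\<^sup>2 \<le>
              Q * ?k * (if j \<in> ?J then (\<theta> n (Suc j))\<^sup>2 else 0) + \<tau> * ?k * (\<theta> n (Suc j))\<^sup>2"
          proof (cases "j \<in> ?J")
            case True
            have "(\<kappa> n (Suc j))\<^sup>2 \<le> (\<kappa> n 1)\<^sup>2" using A1 n unfolding cond_A1_def by auto
            also have "\<dots> \<le> Q * ?k" by (rule elim(1))
            finally have "(\<kappa> n (Suc j))\<^sup>2 * (\<theta> n (Suc j))\<^sup>2 \<le> Q * ?k * (\<theta> n (Suc j))\<^sup>2"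
              by (rule mult_right_mono) simp
            then show ?thesis using True nonneg by simp
          next
            case False
            then have "(\<kappa> n (Suc j))\<^sup>2 \<le> \<tau> * ?k" by (intro tail n) auto
            then have "(\<kappa> n (Suc j))\<^sup>2 * (\<theta> n (Suc j))\<^sup>2 \<le> \<tau> * ?k * (\<theta> n (Suc j))\<^sup>2"
              by (rule mult_right_mono) simp
            then show ?thesis using False nonneg by simp
          qed
        qed
        also have "\<dots> = Q * ?k * low c2 n + \<tau> * ?k * (\<Sum>j. (\<theta> n (Suc j))\<^sup>2)"
          by (rule sums_unique[symmetric]) (intro sums_add sums_mult sumsJ summable_sums \<theta>(1) n)
        also have "\<dots> \<le> Q * ?k * (\<gamma> * p n) + \<tau> * ?k * (B * p n)"
          using elim p[OF n] low0[of c2 n] \<theta>(3)[OF n] \<tau>\<gamma> k0 q(2)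
          by (intro add_mono mult_left_mono) auto
        finally have "(real n)\<^sup>2 * E n \<le> (real n)\<^sup>2 * (Q * ?k * (\<gamma> * p n) + \<tau> * ?k * (B * p n))"
          by (intro mult_left_mono) auto
        also have "\<dots> = (real n)\<^sup>2 * p n * ?k * (Q * \<gamma> + \<tau> * B)" by (simp add: algebra_simps)
        also have "\<dots> \<le> K * (Q * \<gamma> + \<tau> * B)"
          using upper(2)[OF n] \<tau>\<gamma> q(2) \<theta>(2) by (intro mult_right_mono) auto
        finally show ?case using total by simp
      qed
    qed
  qed
  then show ?thesis unfolding E_def low_eq by simp
qed


section \<open>From the white noise model to the Gaussian sequence\<close>

lemma white_noise_gaussian_sequence:
  assumes W: "white_noise M W" and e: "L2_orthonormal e"
  shows "gaussian_sequence M (\<lambda>j. W (e (Suc j)))"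
proof -
  interpret prob_space M using W by (simp add: white_noise_def)
  have ind: "indep_vars (\<lambda>_. borel) (\<lambda>j. W (e j)) {1..}"
    and dist: "\<And>j. 1 \<le> j \<Longrightarrow> distributed M lborel (W (e j)) std_normal_density"
    using W e unfolding white_noise_def by blast+
  have "indep_vars (\<lambda>j. Pi\<^sub>M {Suc j} (\<lambda>_. borel)) (\<lambda>j \<omega>. restrict (\<lambda>i. W (e i) \<omega>) {Suc j}) UNIV"
    by (rule indep_vars_restrict[OF ind]) (auto simp: disjoint_family_on_def)
  then have "indep_vars (\<lambda>_. borel) (\<lambda>j \<omega>. (\<lambda>g. g (Suc j)) (restrict (\<lambda>i. W (e i) \<omega>) {Suc j})) UNIV"
    by (rule indep_vars_compose2) (auto intro!: measurable_component_singleton)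
  then have "indep_vars (\<lambda>_. borel) (\<lambda>j. W (e (Suc j))) UNIV" by simp
  then show ?thesis
    using dist by unfold_locales auto
qed

lemma T_stat_eq_centred_quad:
  assumes \<sigma>: "0 < \<sigma>" and n: "1 \<le> n" and \<kappa>: "summable (\<lambda>j. (\<kappa> n (Suc j))\<^sup>2)"
    and y: "\<And>j. y (Suc j) = \<sigma> / sqrt (real n) * z j"
    and z: "summable (\<lambda>j. real n / \<sigma>\<^sup>2 * (\<kappa> n (Suc j))\<^sup>2 * (z j)\<^sup>2)"
  shows "T_stat \<sigma> \<kappa> n y =
    \<sigma> ^ 4 / (real n)\<^sup>2 * centred_quad (\<lambda>j. real n / \<sigma>\<^sup>2 * (\<kappa> n (Suc j))\<^sup>2) z"
proof -
  define a where "a j = real n / \<sigma>\<^sup>2 * (\<kappa> n (Suc j))\<^sup>2" for j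
  have n0: "0 < real n" using n by simp
  have a: "summable a" "\<sigma> ^ 4 / (real n)\<^sup>2 * (\<Sum>j. a j) = \<sigma>\<^sup>2 / real n * rho \<kappa> n"
  proof -
    show "summable a"
      unfolding a_def[abs_def] by (rule summable_mult[OF \<kappa>])
    show "\<sigma> ^ 4 / (real n)\<^sup>2 * (\<Sum>j. a j) = \<sigma>\<^sup>2 / real n * rho \<kappa> n"
      using \<sigma> n0 unfolding a_def rho_def suminf_mult[OF \<kappa>]
      by (simp add: field_simps power2_eq_square eval_nat_numeral)
  qed
  have az: "summable (\<lambda>j. a j * (z j)\<^sup>2)" using z by (simp add: a_def)
  have "(\<kappa> n (Suc j))\<^sup>2 * (y (Suc j))\<^sup>2 = \<sigma> ^ 4 / (real n)\<^sup>2 * (a j * (z j)\<^sup>2)" for j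
    using \<sigma> n0 by (simp add: a_def y power_mult_distrib power_divide field_simps power2_eq_square eval_nat_numeral)
  then have "T_stat \<sigma> \<kappa> n y = \<sigma> ^ 4 / (real n)\<^sup>2 * (\<Sum>j. a j * (z j)\<^sup>2) - \<sigma> ^ 4 / (real n)\<^sup>2 * (\<Sum>j. a j)"
    unfolding T_stat_def a(2) by (simp only: suminf_mult[OF az])
  also have "\<dots> = \<sigma> ^ 4 / (real n)\<^sup>2 * (\<Sum>j. a j * (z j)\<^sup>2 - a j)"
    by (simp add: suminf_diff[OF az a(1), symmetric] right_diff_distrib)
  also have "(\<lambda>j. a j * (z j)\<^sup>2 - a j) = (\<lambda>j. a j * ((z j)\<^sup>2 - 1))"
    by (simp add: fun_eq_iff right_diff_distrib)
  finally show ?thesis by (simp add: centred_quad_def a_def)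
qed

text \<open>
  The normalisation of the statistic holds only where the series in \<open>T_stat\<close> converges, hence
  almost surely, which is enough for the probabilities.
\<close>

lemma prob_threshold_T_stat:
  assumes noise: "gaussian_sequence M \<xi>" and \<sigma>: "0 < \<sigma>" and n: "1 \<le> n"
    and \<kappa>: "summable (\<lambda>j. (\<kappa> n (Suc j))\<^sup>2)"
    and b: "summable (\<lambda>j. real n / \<sigma>\<^sup>2 * (\<kappa> n (Suc j))\<^sup>2 * (b j)\<^sup>2)"
    and y: "\<And>\<omega> j. y \<omega> (Suc j) = \<sigma> / sqrt (real n) * (\<xi> j \<omega> + b j)"
  defines "U \<equiv> \<lambda>\<omega>. centred_quad (\<lambda>j. real n / \<sigma>\<^sup>2 * (\<kappa> n (Suc j))\<^sup>2) (\<lambda>j. \<xi> j \<omega> + b j)"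
  shows "measure M {\<omega> \<in> space M. T_stat \<sigma> \<kappa> n (y \<omega>) > x} = measure M {\<omega> \<in> space M. U \<omega> > x * (real n)\<^sup>2 / \<sigma> ^ 4}"
    and "measure M {\<omega> \<in> space M. \<not> T_stat \<sigma> \<kappa> n (y \<omega>) > x} = measure M {\<omega> \<in> space M. \<not> U \<omega> > x * (real n)\<^sup>2 / \<sigma> ^ 4}"
proof -
  interpret gaussian_sequence M \<xi> by fact
  have [measurable]: "U \<in> borel_measurable M" unfolding U_def by measurable
  have [measurable]: "(\<lambda>\<omega>. T_stat \<sigma> \<kappa> n (y \<omega>)) \<in> borel_measurable M"
    unfolding T_stat_def y by measurable
  have "AE \<omega> in M. summable (\<lambda>j. real n / \<sigma>\<^sup>2 * (\<kappa> n (Suc j))\<^sup>2 * (\<xi> j \<omega> + b j)\<^sup>2)"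
    by (rule AE_summable_shifted_squares[OF _ summable_mult[OF \<kappa>] b]) simp
  then have iff: "AE \<omega> in M. T_stat \<sigma> \<kappa> n (y \<omega>) > x \<longleftrightarrow> U \<omega> > x * (real n)\<^sup>2 / \<sigma> ^ 4"
  proof eventually_elim
    case (elim \<omega>)
    have "T_stat \<sigma> \<kappa> n (y \<omega>) = \<sigma> ^ 4 / (real n)\<^sup>2 * U \<omega>"
      unfolding U_def by (rule T_stat_eq_centred_quad[where \<kappa>=\<kappa> and y="y \<omega>" and z="\<lambda>j. \<xi> j \<omega> + b j", OF \<sigma> n \<kappa> y elim])
    then have "T_stat \<sigma> \<kappa> n (y \<omega>) * (real n)\<^sup>2 / \<sigma> ^ 4 = U \<omega>"
      using \<sigma> n by simp
    moreover have "x < t \<longleftrightarrow> x * (real n)\<^sup>2 / \<sigma> ^ 4 < t * (real n)\<^sup>2 / \<sigma> ^ 4" for t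
      using \<sigma> n by (simp add: divide_less_cancel)
    ultimately show ?case by metis
  qed
  show "prob {\<omega> \<in> space M. T_stat \<sigma> \<kappa> n (y \<omega>) > x} = prob {\<omega> \<in> space M. U \<omega> > x * (real n)\<^sup>2 / \<sigma> ^ 4}"
    by (rule finite_measure_eq_AE) (use iff in auto)
  show "prob {\<omega> \<in> space M. \<not> T_stat \<sigma> \<kappa> n (y \<omega>) > x} = prob {\<omega> \<in> space M. \<not> U \<omega> > x * (real n)\<^sup>2 / \<sigma> ^ 4}"
    by (rule finite_measure_eq_AE) (use iff in auto)
qed

theorem theorem4p2:
  fixes r \<sigma> c C :: real
    and M :: "'a measure"
    and W :: "(real \<Rightarrow> real) \<Rightarrow> 'a \<Rightarrow> real"
    and \<phi> :: "nat \<Rightarrow> real \<Rightarrow> real"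
    and \<kappa> :: "nat \<Rightarrow> nat \<Rightarrow> real"
    and f :: "nat \<Rightarrow> real \<Rightarrow> real"
    and \<theta> :: "nat \<Rightarrow> nat \<Rightarrow> real"
  assumes "0 < r" and "r < 1/2" and "0 < \<sigma>"
    and "white_noise M W"
    and "L2_orthonormal_basis \<phi>"
    and "cond_A1 \<kappa>" and "cond_A2 \<sigma> \<kappa>" and "cond_A3 r \<kappa>" and "cond_A4 \<kappa>" and "cond_A5 \<kappa>"
    and "\<And>n. n \<ge> 1 \<Longrightarrow> f n \<in> L2"
    and "\<And>n j. n \<ge> 1 \<Longrightarrow> j \<ge> 1 \<Longrightarrow> \<theta> n j = L2_inner (f n) (\<phi> j)"
    and "0 < c" and "c < C"
    and "\<And>n. n \<ge> 1 \<Longrightarrow>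
           c * real n powr (- r) \<le> L2_norm (f n) \<and> L2_norm (f n) \<le> C * real n powr (- r)"
  shows "inconsistent M W \<sigma> \<phi> \<kappa> f \<longleftrightarrow>
    (\<forall>c2>0. (\<lambda>n. \<Sum>j | 1 \<le> j \<and> real j < c2 * real (k_idx \<kappa> n). (\<theta> n j)\<^sup>2)
               \<in> o(\<lambda>n. real n powr (- 2 * r)))"
proof -
  note \<sigma> = \<open>0 < \<sigma>\<close>
  have e: "L2_orthonormal \<phi>" using assms(5) by (simp add: L2_orthonormal_basis_def)
  define \<xi> where "\<xi> j = W (\<phi> (Suc j))" for j
  have noise: "gaussian_sequence M \<xi>"
    unfolding \<xi>_def using white_noise_gaussian_sequence[OF assms(4) e] .
  interpret gaussian_sequence M \<xi> by (rule noise)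
  define p where "p n = real n powr (- 2 * r)" for n
  have p: "0 < p n" if "1 \<le> n" for n using that by (simp add: p_def)
  obtain C1 C2 where C12: "0 < C1" "0 < C2" and A: "\<And>n. 1 \<le> n \<Longrightarrow> summable (\<lambda>j. (\<kappa> n (Suc j)) ^ 4) \<and>
      C1 < A_coef \<sigma> \<kappa> n \<and> A_coef \<sigma> \<kappa> n < C2"
    using assms(7) unfolding cond_A2_def by blast
  obtain c1 c2 where c12: "0 < c1" "0 < c2" and R: "\<And>n. 1 \<le> n \<Longrightarrow> summable (\<lambda>j. (\<kappa> n (Suc j))\<^sup>2) \<and>
      c1 * p n \<le> rho \<kappa> n \<and> rho \<kappa> n \<le> c2 * p n"
    using assms(8) unfolding cond_A3_def p_def by blast
  obtain K where K: "0 < K" "\<And>n. 1 \<le> n \<Longrightarrow> (real n)\<^sup>2 * p n * kappa_sq \<kappa> n \<le> K"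
    using coefficient_order(1)[OF \<sigma> assms(6-8)] unfolding p_def by blast
  obtain K' where K': "0 < K'" "\<And>n. 1 \<le> n \<Longrightarrow> K' \<le> (real n)\<^sup>2 * p n * (\<kappa> n 1)\<^sup>2"
    using coefficient_order(2)[OF \<sigma> assms(6-8)] unfolding p_def by blast
  have k: "1 \<le> k_idx \<kappa> n" if n: "1 \<le> n" for n
  proof (rule ccontr)
    have "0 < rho \<kappa> n" using R[OF n] c12(1) p[OF n] by (meson less_le_trans mult_pos_pos)
    moreover assume "\<not> 1 \<le> k_idx \<kappa> n"
    ultimately show False using half_mass_up_to_k_idx[of \<kappa> n] R[OF n] by simp
  qed
  have mono: "(\<kappa> n (Suc j))\<^sup>2 \<le> (\<kappa> n 1)\<^sup>2" if "1 \<le> n" for n j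
    using assms(6) that unfolding cond_A1_def by auto

  have \<theta>: "summable (\<lambda>j. (\<theta> n (Suc j))\<^sup>2)" "(\<Sum>j. (\<theta> n (Suc j))\<^sup>2) \<le> C\<^sup>2 * p n" if n: "1 \<le> n" for n
  proof -
    have eq: "\<theta> n (Suc j) = L2_inner (f n) (\<phi> (Suc j))" for j using assms(12) n by simp
    have b: "summable (\<lambda>j. (\<theta> n (Suc j))\<^sup>2)" "(\<Sum>j. (\<theta> n (Suc j))\<^sup>2) \<le> (L2_norm (f n))\<^sup>2"
      using bessel_L2[OF e assms(11)[OF n]] unfolding eq by auto
    have "0 \<le> L2_norm (f n)" by (simp add: L2_norm_def)
    then have "(L2_norm (f n))\<^sup>2 \<le> (C * real n powr (- r))\<^sup>2"
      using assms(15)[OF n] by (intro power_mono) auto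
    also have "\<dots> = C\<^sup>2 * p n"
      by (simp add: p_def power_mult_distrib power2_eq_square flip: powr_add)
    finally show "summable (\<lambda>j. (\<theta> n (Suc j))\<^sup>2)" "(\<Sum>j. (\<theta> n (Suc j))\<^sup>2) \<le> C\<^sup>2 * p n"
      using b by auto
  qed
  have \<kappa>\<theta>: "summable (\<lambda>j. (\<kappa> n (Suc j))\<^sup>2 * (\<theta> n (Suc j))\<^sup>2)" if n: "1 \<le> n" for n
    by (rule summable_comparison_test'[OF summable_mult[OF \<theta>(1)[OF n], of "(\<kappa> n 1)\<^sup>2"]])
      (use mono[OF n] in \<open>auto intro: mult_right_mono\<close>)

  define a where "a n j = real n / \<sigma>\<^sup>2 * (\<kappa> n (Suc j))\<^sup>2" for n j
  define b where "b n j = sqrt (real n) * \<theta> n (Suc j) / \<sigma>" for n j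
  define m where "m n = real n / \<sigma>\<^sup>2 * (\<kappa> n 1)\<^sup>2" for n
  have ab: "a n j * (b n j)\<^sup>2 = (real n)\<^sup>2 / \<sigma> ^ 4 * ((\<kappa> n (Suc j))\<^sup>2 * (\<theta> n (Suc j))\<^sup>2)" for n j
    using \<sigma> by (simp add: a_def b_def power_mult_distrib power_divide field_simps power2_eq_square eval_nat_numeral)
  have sum_ab: "summable (\<lambda>j. a n j * (b n j)\<^sup>2)"
      "(\<Sum>j. a n j * (b n j)\<^sup>2) = (real n)\<^sup>2 * (\<Sum>j. (\<kappa> n (Suc j))\<^sup>2 * (\<theta> n (Suc j))\<^sup>2) / \<sigma> ^ 4"
    if "1 \<le> n" for n
    unfolding ab suminf_mult[OF \<kappa>\<theta>[OF that]] by (rule summable_mult[OF \<kappa>\<theta>[OF that]], simp)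
  have a2: "(a n j)\<^sup>2 = (real n)\<^sup>2 / \<sigma> ^ 4 * (\<kappa> n (Suc j)) ^ 4" for n j
    by (simp add: a_def power_mult_distrib power_divide flip: power_mult)
  have sum_a2: "summable (\<lambda>j. (a n j)\<^sup>2)" "(\<Sum>j. (a n j)\<^sup>2) = A_coef \<sigma> \<kappa> n" if "1 \<le> n" for n
    unfolding a2 A_coef_def using A[OF that] by (auto simp only: suminf_mult intro!: summable_mult)

  have m_lim: "m \<longlonglongrightarrow> 0"
  proof -
    obtain q Q where q: "0 < q" "0 < Q"
      and cmp: "\<forall>\<^sub>F n in sequentially. q \<le> (\<kappa> n 1)\<^sup>2 / kappa_sq \<kappa> n \<and> (\<kappa> n 1)\<^sup>2 / kappa_sq \<kappa> n \<le> Q"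
      using assms(10) unfolding cond_A5_def asymp_comparable_def by blast
    have "(\<lambda>n. Q * K / \<sigma>\<^sup>2 * real n powr (2 * r - 1)) \<longlonglongrightarrow> Q * K / \<sigma>\<^sup>2 * 0"
      using assms(2) by (intro tendsto_intros tendsto_neg_powr filterlim_real_sequentially) auto
    then have "(\<lambda>n. Q * K / \<sigma>\<^sup>2 * real n powr (2 * r - 1)) \<longlonglongrightarrow> 0" by simp
    then show ?thesis
    proof (rule tendsto_0_le[where K=1])
      show "\<forall>\<^sub>F n in sequentially. norm (m n) \<le> norm (Q * K / \<sigma>\<^sup>2 * real n powr (2 * r - 1)) * 1"
        using cmp eventually_ge_at_top[of 1]
      proof eventually_elim
        case (elim n)
        then have "kappa_sq \<kappa> n \<noteq> 0" using q(1) by auto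
        then have "0 < kappa_sq \<kappa> n" by (simp add: kappa_sq_def)
        then have \<kappa>1: "(\<kappa> n 1)\<^sup>2 \<le> Q * kappa_sq \<kappa> n" using elim by (simp add: field_simps)
        have n0: "0 < real n" using elim by simp
        \<comment> \<open>trade one factor \<open>n\<close> for \<open>n\<^sup>2 p\<close>, the scale in which \<open>kappa_sq\<close> is bounded; the rest
          tends to 0 because \<open>r < 1/2\<close>\<close>
        have np: "real n * p n * real n powr (2 * r - 1) = 1"
          using n0 by (simp add: p_def powr_mult_base powr_add[symmetric])
        have "m n = real n / \<sigma>\<^sup>2 * (\<kappa> n 1)\<^sup>2 * (real n * p n * real n powr (2 * r - 1))"
          unfolding np by (simp add: m_def)
        also have "\<dots> = (real n)\<^sup>2 * p n * (\<kappa> n 1)\<^sup>2 * (real n powr (2 * r - 1) / \<sigma>\<^sup>2)"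
          by (simp add: power2_eq_square)
        also have "\<dots> \<le> (real n)\<^sup>2 * p n * (Q * kappa_sq \<kappa> n) * (real n powr (2 * r - 1) / \<sigma>\<^sup>2)"
          using \<kappa>1 p[of n] elim by (intro mult_right_mono mult_left_mono) auto
        also have "\<dots> = Q * ((real n)\<^sup>2 * p n * kappa_sq \<kappa> n) * (real n powr (2 * r - 1) / \<sigma>\<^sup>2)"
          by simp
        also have "\<dots> \<le> Q * K * (real n powr (2 * r - 1) / \<sigma>\<^sup>2)"
          using K(2)[of n] elim q(2) by (intro mult_right_mono mult_left_mono) auto
        finally have "m n \<le> Q * K / \<sigma>\<^sup>2 * real n powr (2 * r - 1)" by simp
        moreover have "0 \<le> m n" by (simp add: m_def)
        ultimately show ?case using q(2) K(1) by simp
      qed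
    qed
  qed

  have type1: "type1_error M W \<sigma> \<phi> n (\<lambda>y. T_stat \<sigma> \<kappa> n y > x) =
      prob {\<omega> \<in> space M. centred_quad (a n) (\<lambda>j. \<xi> j \<omega>) > x * (real n)\<^sup>2 / \<sigma> ^ 4}" if n: "1 \<le> n" for n x
    using prob_threshold_T_stat(1)[where \<kappa>=\<kappa> and b="\<lambda>_. 0" and x=x and
        y="observation \<sigma> W \<phi> n (\<lambda>_. 0)", OF noise \<sigma> n conjunct1[OF R[OF n]]]
    by (simp add: type1_error_def observation_def dY_integral_def L2_inner_def \<xi>_def a_def[abs_def])
  have type2: "type2_error M W \<sigma> \<phi> n (\<lambda>y. T_stat \<sigma> \<kappa> n y > x) (f n) =
      prob {\<omega> \<in> space M. \<not> centred_quad (a n) (\<lambda>j. \<xi> j \<omega> + b n j) > x * (real n)\<^sup>2 / \<sigma> ^ 4}"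
    if n: "1 \<le> n" for n x
  proof -
    have "observation \<sigma> W \<phi> n (f n) \<omega> (Suc j) = \<sigma> / sqrt (real n) * (\<xi> j \<omega> + b n j)" for \<omega> j
      using assms(12)[OF n, of "Suc j"] n \<sigma>
      by (simp add: observation_def dY_integral_def \<xi>_def b_def field_simps)
    moreover have "summable (\<lambda>j. real n / \<sigma>\<^sup>2 * (\<kappa> n (Suc j))\<^sup>2 * (b n j)\<^sup>2)"
      using sum_ab(1)[OF n] by (simp add: a_def)
    ultimately show ?thesis
      using prob_threshold_T_stat(2)[where \<kappa>=\<kappa> and b="b n" and x=x and
        y="observation \<sigma> W \<phi> n (f n)", OF noise \<sigma> n conjunct1[OF R[OF n]]]
      by (simp add: type2_error_def a_def[abs_def])
  qed
  have errors: "type1_error M W \<sigma> \<phi> n (\<lambda>y. T_stat \<sigma> \<kappa> n y > x) +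
      type2_error M W \<sigma> \<phi> n (\<lambda>y. T_stat \<sigma> \<kappa> n y > x) (f n) = error_sum (a n) (b n) (x * (real n)\<^sup>2 / \<sigma> ^ 4)"
    if "1 \<le> n" for n x
    unfolding error_sum_def type1[OF that] type2[OF that] ..

  have "inconsistent M W \<sigma> \<phi> \<kappa> f \<longleftrightarrow> (\<forall>x. 1 \<le> liminf (\<lambda>n. ereal (error_sum (a n) (b n) (x n))))"
  proof
    assume inc: "inconsistent M W \<sigma> \<phi> \<kappa> f"
    show "\<forall>x. 1 \<le> liminf (\<lambda>n. ereal (error_sum (a n) (b n) (x n)))"
    proof
      fix x :: "nat \<Rightarrow> real"
      define K where "K n = (\<lambda>y. T_stat \<sigma> \<kappa> n y > x n * \<sigma> ^ 4 / (real n)\<^sup>2)" for n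
      have "1 \<le> liminf (\<lambda>n. ereal (type1_error M W \<sigma> \<phi> n (K n) + type2_error M W \<sigma> \<phi> n (K n) (f n)))"
        using inc unfolding inconsistent_def by (auto simp: generated_by_def K_def)
      also have "\<dots> = liminf (\<lambda>n. ereal (error_sum (a n) (b n) (x n)))"
      proof (rule Liminf_eq, rule eventually_mono[OF eventually_ge_at_top[of 1]])
        fix n :: nat assume n: "1 \<le> n"
        then have "x n * \<sigma> ^ 4 / (real n)\<^sup>2 * (real n)\<^sup>2 / \<sigma> ^ 4 = x n" using \<sigma> by simp
        then show "ereal (type1_error M W \<sigma> \<phi> n (K n) + type2_error M W \<sigma> \<phi> n (K n) (f n)) =
            ereal (error_sum (a n) (b n) (x n))"
          unfolding K_def errors[OF n] by simp
      qed
      finally show "1 \<le> liminf (\<lambda>n. ereal (error_sum (a n) (b n) (x n)))" .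
    qed
  next
    assume all: "\<forall>x. 1 \<le> liminf (\<lambda>n. ereal (error_sum (a n) (b n) (x n)))"
    show "inconsistent M W \<sigma> \<phi> \<kappa> f"
      unfolding inconsistent_def
    proof (intro allI impI)
      fix K :: "nat \<Rightarrow> (nat \<Rightarrow> real) \<Rightarrow> bool"
      assume "\<forall>n\<ge>1. generated_by (K n) (T_stat \<sigma> \<kappa> n)"
      then have "\<forall>n. \<exists>x. 1 \<le> n \<longrightarrow> K n = (\<lambda>y. T_stat \<sigma> \<kappa> n y > x)"
        unfolding generated_by_def by blast
      then obtain x where x: "\<And>n. 1 \<le> n \<Longrightarrow> K n = (\<lambda>y. T_stat \<sigma> \<kappa> n y > x n)"
        using choice[of "\<lambda>n x. 1 \<le> n \<longrightarrow> K n = (\<lambda>y. T_stat \<sigma> \<kappa> n y > x)"] by blast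
      have "1 \<le> liminf (\<lambda>n. ereal (error_sum (a n) (b n) (x n * (real n)\<^sup>2 / \<sigma> ^ 4)))"
        using all by (rule spec)
      also have "\<dots> = liminf (\<lambda>n. ereal (type1_error M W \<sigma> \<phi> n (K n) + type2_error M W \<sigma> \<phi> n (K n) (f n)))"
        by (rule Liminf_eq, rule eventually_mono[OF eventually_ge_at_top[of 1]]) (simp only: x errors)
      finally show "1 \<le> liminf (\<lambda>n. ereal (type1_error M W \<sigma> \<phi> n (K n) + type2_error M W \<sigma> \<phi> n (K n) (f n)))" .
    qed
  qed
  also have "\<dots> \<longleftrightarrow> (\<lambda>n. \<Sum>j. a n j * (b n j)\<^sup>2) \<longlonglongrightarrow> 0"
  proof (rule no_power_iff_shift_vanishes[where m=m and v=C1 and w=C2])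
    show "0 \<le> a n j" for n j by (simp add: a_def)
    show "a n j \<le> m n" if "1 \<le> n" for n j
      unfolding a_def m_def by (intro mult_left_mono mono that) simp
    show "summable (a n)" if "1 \<le> n" for n
      unfolding a_def[abs_def] using R[OF that] by (intro summable_mult) simp
    show "C1 \<le> (\<Sum>j. (a n j)\<^sup>2)" "(\<Sum>j. (a n j)\<^sup>2) \<le> C2" if "1 \<le> n" for n
      using A[OF that] sum_a2(2)[OF that] by auto
  qed (use C12 m_lim sum_ab sum_a2 in auto)
  also have "\<dots> \<longleftrightarrow>
      (\<lambda>n. (real n)\<^sup>2 * (\<Sum>j. (\<kappa> n (Suc j))\<^sup>2 * (\<theta> n (Suc j))\<^sup>2) / \<sigma> ^ 4) \<longlonglongrightarrow> 0"
    by (rule tendsto_cong, rule eventually_mono[OF eventually_ge_at_top[of 1]]) (rule sum_ab(2))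
  also have "\<dots> \<longleftrightarrow> (\<lambda>n. (real n)\<^sup>2 * (\<Sum>j. (\<kappa> n (Suc j))\<^sup>2 * (\<theta> n (Suc j))\<^sup>2)) \<longlonglongrightarrow> 0"
    using \<sigma> tendsto_mult_left_iff[of "1 / \<sigma> ^ 4"
        "\<lambda>n. (real n)\<^sup>2 * (\<Sum>j. (\<kappa> n (Suc j))\<^sup>2 * (\<theta> n (Suc j))\<^sup>2)" 0 sequentially]
    by simp
  also have "\<dots> \<longleftrightarrow> (\<forall>c2>0. (\<lambda>n. \<Sum>j | 1 \<le> j \<and> real j < c2 * real (k_idx \<kappa> n). (\<theta> n j)\<^sup>2) \<in> o(p))"
    by (rule weighted_energy_vanishes_iff[OF assms(6,9,10) k p K K' \<theta>(1) _ \<theta>(2) \<kappa>\<theta>]) auto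
  finally show ?thesis by (simp add: p_def[abs_def])
qed

end
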